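(* Let $m>1$, $\Delta t>0$, let $\rho_h^{n-1}\in Q_h$ satisfy $\rho_h^{n-1}\ge0$, and let $(\rho_h^n,\mu_h^n,\mathbf{u}_h^n)\in Q_h\times Q_h\times\mathbf{V}_h$ be a solution of the fully discrete mixed scheme $$\mathcal{M}_h\left(\frac{\rho_h^n-\rho_h^{n-1}}{\Delta t},q_h\right)+\mathcal{A}_h\left(\hat\rho_h^{n-1};\mathbf{u}_h^n,q_h\right)=0\quad\text{for all } q_h\in Q_h,$$ $$\bar{\mathcal{M}}_h(\mathbf{u}_h^n,\mathbf{v}_h)-\bar{\mathcal{A}}_h(\mu_h^n,\mathbf{v}_h)=0\quad\text{for all } \mathbf{v}_h\in\mathbf{V}_h,$$ $$\mathcal{M}_h\left(\mu_h^n-\tfrac{m}{m-1}(\rho_h^n)^{m-1},r_h\right)=0\quad\text{for all } r_h\in Q_h,$$ where $\hat\rho_h^{n-1}$ is the upwind flux value defined in the context. Suppose the CFL condition $$\Delta t\sum_{E\in\mathcal{E}_K^-}\left|\mathbf{u}_h^n\cdot\mathbf{n}_K\right|_E\,\frac{|E|}{|K|}\le1\qquad\text{for all } K\in\Omega_h$$ holds, where $\mathcal{E}_K^-=\{E\in\mathcal{E}_K:\ \mathbf{u}_h^n\cdot\mathbf{n}_K|_E\ge0\}$. Then the scheme is positivity preserving: $\rho_h^n\ge0$.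
   Context: $\Omega\subset\mathbb{R}^2$ is a bounded polygonal domain and $\Omega_h$ is a conforming triangulation of $\Omega$ into triangles. $\mathcal{E}_h$ is the set of edges of $\Omega_h$ and $\mathcal{E}_K$ the set of edges of $K\in\Omega_h$; $|E|$ is the length of $E$, $|K|$ the area of $K$, $\mathbf{n}_K$ the outward unit normal on $\partial K$, $\mathbf{n}$ the outward unit normal on $\partial\Omega$, and $\mathbf{n}_E$ a fixed unit normal on the edge $E$. Spaces: $$Q_h=\{q_h\in L^2(\Omega): q_h|_K\in P_0(K)\ \text{for all } K\in\Omega_h\},$$ $$\mathbf{V}_h=\{\mathbf{v}_h\in H(\mathrm{div};\Omega): \mathbf{v}_h|_K\in RT_0(K)\ \text{for all } K\in\Omega_h,\ \mathbf{v}_h\cdot\mathbf{n}=0\text{ on }\partial\Omega\},$$ where $P_0(K)$ is the space of constants and $RT_0(K)=[P_0(K)]^2\oplus\mathbf{x}P_0(K)$ is the lowest-order Raviart–Thomas space. Functions in $\mathbf{V}_h$ have constant normal component on each edge. Operators: $$\mathcal{M}_h(\alpha,\beta)=\sum_{K\in\Omega_h}\int_K\alpha\beta\,dx,\qquad \mathcal{A}_h(\gamma;\boldsymbol\alpha,\beta)=\sum_{K\in\Omega_h}\int_{\partial K}\gamma\,\boldsymbol\alpha\cdot\mathbf{n}_K\,\beta\,ds,\qquad \bar{\mathcal{A}}_h(\alpha,\boldsymbol\beta)=\sum_{K\in\Omega_h}\int_{\partial K}\alpha\,\boldsymbol\beta\cdot\mathbf{n}_K\,ds,$$ where in the integral over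 $\partial K$ the piecewise constant functions $\beta$ and $\alpha$ (in $Q_h$) are evaluated from inside $K$. The velocity mass operator is $\bar{\mathcal{M}}_h(\boldsymbol\alpha,\boldsymbol\beta)=\sum_{K\in\Omega_h}\int_K\boldsymbol\alpha\cdot\boldsymbol\beta\,dx$, either computed exactly or evaluated with the mass-lumping quadrature $\sum_{K\in\Omega_h}\sum_{E\in\mathcal{E}_K}\tfrac12\cot\theta_E^K\,\varphi_E(\boldsymbol\alpha)\varphi_E(\boldsymbol\beta)$, where $\theta_E^K$ is the angle opposite to $E$ in $K$ and $\varphi_E(\boldsymbol\alpha)=\boldsymbol\alpha\cdot\mathbf{n}_E$ is the normal flux through $E$. Upwind flux: on an edge $E$ shared by $K^+$ and $K^-$, with the labels chosen so that $\mathbf{u}_h^n\cdot\mathbf{n}_{K^-}|_E\ge0$, $\hat\rho_h^{n-1}|_E=\rho_h^{n-1}|_{K^-}$. On boundary edges $\mathbf{u}_h^n\cdot\mathbf{n}=0$, so the value of $\hat\rho_h^{n-1}$ there is immaterial (take the value from the adjacent element). Nonnegativity of $\rho_h^n$ is not assumed; for non-integer $m$ the power $(\rho_h^n)^{m-1}$ is understood with any fixed real-valued convention at negative arguments. *)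

theory Defs
  imports "HOL-Analysis.Analysis"
begin

text \<open>The condition \<open>interior (closure \<Omega>) = \<Omega>\<close> excludes slits, across which the outward unit
  normal on the boundary would not be defined.\<close>

definition polygonal_domain :: "(real^2) set \<Rightarrow> bool" where
  "polygonal_domain \<Omega> \<longleftrightarrow>
     open \<Omega> \<and> connected \<Omega> \<and> \<Omega> \<noteq> {} \<and> bounded \<Omega> \<and> interior (closure \<Omega>) = \<Omega> \<and>
     (\<exists>S. finite S \<and> frontier \<Omega> = (\<Union>(a, b)\<in>S. closed_segment a b))"

text \<open>In the library notion \<^const>\<open>triangulation\<close> any two members meet in a common face, possibly
  empty; this is conformity of the mesh.\<close>

definition triangulates :: "(real^2) set set \<Rightarrow> (real^2) set \<Rightarrow> bool" where
  "triangulates T \<Omega> \<longleftrightarrow> triangulation T \<and> (\<forall>K\<in>T. 2 simplex K) \<and> \<Union>T = closure \<Omega>"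

abbreviation edges_of :: "(real^2) set \<Rightarrow> (real^2) set set" where
  "edges_of K \<equiv> {E. E edge_of K}"

definition mesh_edges :: "(real^2) set set \<Rightarrow> (real^2) set set" where
  "mesh_edges T = (\<Union>K\<in>T. edges_of K)"

abbreviation area :: "(real^2) set \<Rightarrow> real" where
  "area K \<equiv> measure lebesgue K"

text \<open>The length of a segment is its diameter.\<close>

abbreviation edge_length :: "(real^2) set \<Rightarrow> real" where
  "edge_length E \<equiv> diameter E"

text \<open>Exchanging \<open>x\<close> and \<open>y\<close> on \<open>E \<subseteq> K\<close> shows that this vector is orthogonal to \<open>E\<close>; the inequality
  then says that it points out of the triangle \<open>K\<close>.\<close>

definition outward_normal :: "(real^2) set \<Rightarrow> (real^2) set \<Rightarrow> real^2" where
  "outward_normal K E = (THE \<nu>. norm \<nu> = 1 \<and> (\<forall>x\<in>E. \<forall>y\<in>K. \<nu> \<bullet> (y - x) \<le> 0))"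

definition unit_normal :: "(real^2) set \<Rightarrow> real^2 \<Rightarrow> bool" where
  "unit_normal E \<nu> \<longleftrightarrow> norm \<nu> = 1 \<and> (\<forall>x\<in>E. \<forall>y\<in>E. \<nu> \<bullet> (y - x) = 0)"

definition opposite_angle :: "(real^2) set \<Rightarrow> (real^2) set \<Rightarrow> real" where
  "opposite_angle K E =
     (THE \<theta>. \<exists>a b c. K = convex hull {a, b, c} \<and> E = closed_segment a b \<and>
        \<theta> = arccos (((a - c) \<bullet> (b - c)) / (norm (a - c) * norm (b - c))))"

text \<open>Integral with respect to arc length; the value does not depend on the order of the endpoints.\<close>

definition edge_integral :: "(real^2) set \<Rightarrow> (real^2 \<Rightarrow> real) \<Rightarrow> real" where
  "edge_integral E f =
     (THE I. \<exists>a b. E = closed_segment a b \<and>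
        I = dist a b * integral {0..1} (\<lambda>t. f (linepath a b t)))"

text \<open>Elements of \<open>L\<^sup>2(\<Omega>)\<close> are represented by functions on the plane; all notions below depend only
  on their almost-everywhere class on \<open>\<Omega>\<close>.\<close>

definition in_L2 :: "(real^2) set \<Rightarrow> (real^2 \<Rightarrow> 'b::euclidean_space) \<Rightarrow> bool" where
  "in_L2 \<Omega> f \<longleftrightarrow>
     set_borel_measurable lebesgue \<Omega> f \<and> set_integrable lebesgue \<Omega> (\<lambda>x. (norm (f x))\<^sup>2)"

definition partial_deriv :: "2 \<Rightarrow> (real^2 \<Rightarrow> real) \<Rightarrow> real^2 \<Rightarrow> real" where
  "partial_deriv i f x = frechet_derivative f (at x) (axis i 1)"

definition grad :: "(real^2 \<Rightarrow> real) \<Rightarrow> real^2 \<Rightarrow> real^2" where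
  "grad f x = (\<chi> i. partial_deriv i f x)"

primrec C_diff :: "nat \<Rightarrow> (real^2 \<Rightarrow> real) \<Rightarrow> bool" where
  "C_diff 0 f \<longleftrightarrow> continuous_on UNIV f"
| "C_diff (Suc k) f \<longleftrightarrow> (\<forall>x. f differentiable (at x)) \<and> (\<forall>i. C_diff k (partial_deriv i f))"

definition test_function :: "(real^2) set \<Rightarrow> (real^2 \<Rightarrow> real) \<Rightarrow> bool" where
  "test_function \<Omega> \<phi> \<longleftrightarrow>
     (\<forall>k. C_diff k \<phi>) \<and> compact (closure {x. \<phi> x \<noteq> 0}) \<and> closure {x. \<phi> x \<noteq> 0} \<subseteq> \<Omega>"

definition weak_divergence :: "(real^2) set \<Rightarrow> (real^2 \<Rightarrow> real^2) \<Rightarrow> (real^2 \<Rightarrow> real) \<Rightarrow> bool" where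
  "weak_divergence \<Omega> v d \<longleftrightarrow>
     (\<forall>\<phi>. test_function \<Omega> \<phi> \<longrightarrow>
        (LINT x:\<Omega>|lebesgue. v x \<bullet> grad \<phi> x) = - (LINT x:\<Omega>|lebesgue. d x * \<phi> x))"

definition in_Hdiv :: "(real^2) set \<Rightarrow> (real^2 \<Rightarrow> real^2) \<Rightarrow> bool" where
  "in_Hdiv \<Omega> v \<longleftrightarrow> in_L2 \<Omega> v \<and> (\<exists>d. in_L2 \<Omega> d \<and> weak_divergence \<Omega> v d)"

definition RT0 :: "(real^2 \<Rightarrow> real^2) set" where
  "RT0 = {p. \<exists>a b. p = (\<lambda>x. a + b *\<^sub>R x)}"

definition Qh :: "(real^2) set \<Rightarrow> (real^2) set set \<Rightarrow> (real^2 \<Rightarrow> real) set" where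
  "Qh \<Omega> T = {q. in_L2 \<Omega> q \<and> (\<forall>K\<in>T. \<exists>c. AE x\<in>K in lebesgue. q x = c)}"

text \<open>The constant value on \<open>K\<close> and the Raviart--Thomas polynomial on \<open>K\<close>. They give the traces from
  inside \<open>K\<close> on its boundary, where the almost-everywhere class itself has no values.\<close>

definition cell_value :: "(real^2) set \<Rightarrow> (real^2 \<Rightarrow> real) \<Rightarrow> real" where
  "cell_value K q = (THE c. AE x\<in>K in lebesgue. q x = c)"

definition cell_field :: "(real^2) set \<Rightarrow> (real^2 \<Rightarrow> real^2) \<Rightarrow> real^2 \<Rightarrow> real^2" where
  "cell_field K v = (THE p. p \<in> RT0 \<and> (AE x\<in>K in lebesgue. v x = p x))"

text \<open>The constant value on \<open>E\<close> of the component along \<open>\<nu>\<close>, where \<open>\<nu>\<close> is normal to the edge \<open>E\<close> of \<open>K\<close>.\<close>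

definition normal_component ::
    "(real^2) set \<Rightarrow> (real^2) set \<Rightarrow> (real^2 \<Rightarrow> real^2) \<Rightarrow> real^2 \<Rightarrow> real" where
  "normal_component K E v \<nu> = (THE c. \<forall>x\<in>E. cell_field K v x \<bullet> \<nu> = c)"

abbreviation outflow :: "(real^2) set \<Rightarrow> (real^2) set \<Rightarrow> (real^2 \<Rightarrow> real^2) \<Rightarrow> real" where
  "outflow K E v \<equiv> normal_component K E v (outward_normal K E)"

text \<open>On an edge of \<open>K\<close> contained in the boundary of \<open>\<Omega>\<close>, the outward normals of \<open>\<Omega>\<close> and of \<open>K\<close>
  coincide.\<close>

definition Vh :: "(real^2) set \<Rightarrow> (real^2) set set \<Rightarrow> (real^2 \<Rightarrow> real^2) set" where
  "Vh \<Omega> T = {v. in_Hdiv \<Omega> v \<and>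
     (\<forall>K\<in>T. \<exists>p\<in>RT0. AE x\<in>K in lebesgue. v x = p x) \<and>
     (\<forall>K\<in>T. \<forall>E\<in>edges_of K. E \<subseteq> frontier \<Omega> \<longrightarrow>
        (\<forall>x\<in>E. cell_field K v x \<bullet> outward_normal K E = 0))}"

definition mass :: "(real^2) set set \<Rightarrow> (real^2 \<Rightarrow> real) \<Rightarrow> (real^2 \<Rightarrow> real) \<Rightarrow> real" where
  "mass T \<alpha> \<beta> = (\<Sum>K\<in>T. LINT x:K|lebesgue. \<alpha> x * \<beta> x)"

text \<open>The first argument \<open>\<gamma>\<close> is a numerical flux value, constant on each edge.\<close>

definition advection ::
    "(real^2) set set \<Rightarrow> ((real^2) set \<Rightarrow> real) \<Rightarrow> (real^2 \<Rightarrow> real^2) \<Rightarrow> (real^2 \<Rightarrow> real) \<Rightarrow> real" where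
  "advection T \<gamma> \<alpha> \<beta> =
     (\<Sum>K\<in>T. \<Sum>E\<in>edges_of K.
        edge_integral E (\<lambda>x. \<gamma> E * (cell_field K \<alpha> x \<bullet> outward_normal K E) * cell_value K \<beta>))"

definition advection_bar ::
    "(real^2) set set \<Rightarrow> (real^2 \<Rightarrow> real) \<Rightarrow> (real^2 \<Rightarrow> real^2) \<Rightarrow> real" where
  "advection_bar T \<alpha> \<beta> =
     (\<Sum>K\<in>T. \<Sum>E\<in>edges_of K.
        edge_integral E (\<lambda>x. cell_value K \<alpha> * (cell_field K \<beta> x \<bullet> outward_normal K E)))"

definition velocity_mass ::
    "(real^2) set set \<Rightarrow> (real^2 \<Rightarrow> real^2) \<Rightarrow> (real^2 \<Rightarrow> real^2) \<Rightarrow> real" where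
  "velocity_mass T \<alpha> \<beta> = (\<Sum>K\<in>T. LINT x:K|lebesgue. \<alpha> x \<bullet> \<beta> x)"

definition velocity_mass_lumped ::
    "(real^2) set set \<Rightarrow> ((real^2) set \<Rightarrow> real^2) \<Rightarrow>
     (real^2 \<Rightarrow> real^2) \<Rightarrow> (real^2 \<Rightarrow> real^2) \<Rightarrow> real" where
  "velocity_mass_lumped T nE \<alpha> \<beta> =
     (\<Sum>K\<in>T. \<Sum>E\<in>edges_of K. 1/2 * cot (opposite_angle K E) *
        normal_component K E \<alpha> (nE E) * normal_component K E \<beta> (nE E))"

text \<open>On an interior edge, \<open>K\<close> is the element labelled \<open>K\<^sup>-\<close>; if the normal flux vanishes, either
  adjacent element may carry this label. A boundary edge has a single adjacent element, with zero
  flux for fields in \<^const>\<open>Vh\<close>.\<close>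

definition upwind_value ::
    "(real^2) set set \<Rightarrow> (real^2 \<Rightarrow> real^2) \<Rightarrow> (real^2 \<Rightarrow> real) \<Rightarrow> ((real^2) set \<Rightarrow> real) \<Rightarrow> bool" where
  "upwind_value T u \<rho> \<rho>hat \<longleftrightarrow>
     (\<forall>E\<in>mesh_edges T. \<exists>K\<in>T. E edge_of K \<and> 0 \<le> outflow K E u \<and> \<rho>hat E = cell_value K \<rho>)"

text \<open>\<open>pow\<close> is the power with exponent \<open>m - 1\<close>; it is arbitrary at negative arguments unless the
  exponent is an integer.\<close>

definition power_convention :: "real \<Rightarrow> (real \<Rightarrow> real) \<Rightarrow> bool" where
  "power_convention m pow \<longleftrightarrow>
     (\<forall>s\<ge>0. pow s = s powr (m - 1)) \<and>
     (\<forall>k::nat. m - 1 = real k \<longrightarrow> (\<forall>s. pow s = s ^ k))"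

definition outflow_edges :: "(real^2) set \<Rightarrow> (real^2 \<Rightarrow> real^2) \<Rightarrow> (real^2) set set" where
  "outflow_edges K u = {E \<in> edges_of K. 0 \<le> outflow K E u}"

definition CFL_condition :: "(real^2) set set \<Rightarrow> real \<Rightarrow> (real^2 \<Rightarrow> real^2) \<Rightarrow> bool" where
  "CFL_condition T \<Delta>t u \<longleftrightarrow>
     (\<forall>K\<in>T. \<Delta>t * (\<Sum>E\<in>outflow_edges K u. \<bar>outflow K E u\<bar> * (edge_length E / area K)) \<le> 1)"

end

theory Submission
  imports Defs "HOL-Computational_Algebra.Polynomial"
begin

text \<open>
  Testing the mass equation with the indicator function of a triangle \<open>K\<close> gives
  \<open>\<rho>\<^sub>K = \<rho>\<^sub>K\<^sup>o\<^sup>l\<^sup>d - \<Delta>t / |K| \<Sum>\<^sub>E |E| \<rho>hat\<^sub>E (u \<bullet> n\<^sub>K)\<^sub>E\<close>. By upwinding, the inflow edges contribute a nonnegative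
  amount, while \<open>\<rho>hat\<^sub>E = \<rho>\<^sub>K\<^sup>o\<^sup>l\<^sup>d\<close> on the edges with strictly positive outflow, so the CFL condition
  bounds the loss by \<open>\<rho>\<^sub>K\<^sup>o\<^sup>l\<^sup>d\<close>. That the upwind element of an outflow edge of \<open>K\<close> is \<open>K\<close> itself rests on
  the continuity of the normal component of \<open>H(div)\<close> fields across a shared edge. It follows by testing
  the weak divergence with radial bumps shrinking to the midpoint of the edge.
\<close>

section \<open>Smooth radial bumps\<close>

text \<open>The obstacle is that membership in \<open>Vh\<close> says nothing pointwise about
  interior edges: \<open>in_Hdiv\<close> is an identity of volume integrals against smooth
  functions, and the polynomials \<open>cell_field\<close> on two neighbouring triangles are a
  priori unrelated. If fluxes could jump, both neighbours of an edge might have positive outflow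
  there, \<open>upwind_value\<close> could pick either, and a triangle could lose mass at a rate set
  by its neighbour's density, which the CFL sum does not control. The jump is excluded by a blow-up
  instead of a divergence theorem on triangles. After rescaling to the unit disc the field is, to
  leading order, constant on each side of a line, and for a radial test function symmetry alone
  reduces the integral to a positive number times the jump. In the plane this term scales like
  \<epsilon>. The divergence is merely square integrable, yet its contribution is also bounded by
  \<epsilon> times its L^2 norm on the disc, and that norm tends to 0 as the disc shrinks.\<close>

text \<open>These functions are closed under differentiation, so smoothness needs no control of iterated
  derivatives.\<close>

definition flat_fn :: "real poly \<Rightarrow> real \<Rightarrow> real" where
  "flat_fn p s = (if s > 0 then poly p (1 / s) * exp (- (1 / s)) else 0)"

text \<open>With z = 1/s one has d/ds = -z^2 d/dz, which turns p(z) exp(-z) into z^2 (p - p')(z)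
  exp(-z).\<close>

definition flat_deriv :: "real poly \<Rightarrow> real poly" where
  "flat_deriv p = monom 1 2 * (p - pderiv p)"

lemma poly_times_exp_tendsto_0: "((\<lambda>z::real. poly p z * exp (- z)) \<longlongrightarrow> 0) at_top"
proof (induction p)
  case 0
  show ?case by simp
next
  case (pCons a p)
  have "((\<lambda>z::real. z ^ k * exp (- z)) \<longlongrightarrow> 0) at_top" for k
    using tendsto_power_div_exp_0[of k] by (simp add: exp_minus field_simps)
  then have *: "((\<lambda>z. c * (z ^ k * exp (- z))) \<longlongrightarrow> 0) at_top" for c :: real and k
    by (auto intro: tendsto_mult_right_zero)
  have "((\<lambda>z. \<Sum>i\<le>degree (pCons a p). coeff (pCons a p) i * (z ^ i * exp (- z))) \<longlongrightarrow> 0) at_top"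
    by (intro tendsto_null_sum *)
  then show ?case
    by (simp add: poly_altdef sum_distrib_right mult.assoc)
qed

text \<open>This is the difference quotient of \<open>flat_fn p\<close> at 0, the only point where
  differentiability is in doubt. Dividing by s multiplies the polynomial in 1/s by its variable,
  hence \<open>pCons 0 p\<close>.\<close>

lemma flat_fn_over_arg_tendsto_0: "((\<lambda>s. flat_fn p s / s) \<longlongrightarrow> 0) (at 0)"
proof -
  have "((\<lambda>z. poly (pCons 0 p) z * exp (- z)) \<longlongrightarrow> 0) at_top"
    by (rule poly_times_exp_tendsto_0)
  then have "((\<lambda>s. poly (pCons 0 p) (inverse s) * exp (- inverse s)) \<longlongrightarrow> 0) (at_right (0::real))"
    by (rule filterlim_compose[OF _ filterlim_inverse_at_top_right])
  then have "((\<lambda>s. flat_fn p s / s) \<longlongrightarrow> 0) (at_right 0)"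
    by (rule Lim_transform_eventually)
       (auto simp: eventually_at_right_field flat_fn_def field_simps intro!: exI[of _ 1])
  moreover have "((\<lambda>s. flat_fn p s / s) \<longlongrightarrow> 0) (at_left 0)"
    by (rule Lim_transform_eventually[OF tendsto_const])
       (auto simp: eventually_at_left_field flat_fn_def intro!: exI[of _ "-1"])
  ultimately show ?thesis
    by (simp add: filterlim_at_split)
qed

lemma flat_fn_has_derivative [derivative_intros]:
  "(flat_fn p has_real_derivative flat_fn (flat_deriv p) s) (at s)"
proof -
  consider "s < 0" | "s = 0" | "s > 0" by linarith
  then show ?thesis
  proof cases
    case 1
    have "((\<lambda>_. 0) has_real_derivative flat_fn (flat_deriv p) s) (at s)"
      using 1 by (simp add: flat_fn_def)
    then show ?thesis
      by (rule has_field_derivative_transform_within_open[where S="{..<0}"])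
         (use 1 in \<open>auto simp: flat_fn_def\<close>)
  next
    case 2
    then show ?thesis
      using flat_fn_over_arg_tendsto_0[of p] by (simp add: has_field_derivative_iff flat_fn_def)
  next
    case 3
    have "((\<lambda>s. poly p (1 / s) * exp (- (1 / s))) has_real_derivative flat_fn (flat_deriv p) s) (at s)"
      using 3
      by (auto intro!: derivative_eq_intros DERIV_chain2[OF poly_DERIV]
          simp: flat_fn_def flat_deriv_def poly_monom field_simps power2_eq_square)
    then show ?thesis
      by (rule has_field_derivative_transform_within_open[where S="{0<..}"])
         (use 3 in \<open>auto simp: flat_fn_def\<close>)
  qed
qed

section \<open>Differentiation rules for smooth functions on the plane\<close>

lemma partial_deriv_eqI:
  "(f has_derivative f') (at x) \<Longrightarrow> partial_deriv i f x = f' (axis i 1)"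
  unfolding partial_deriv_def using frechet_derivative_at by metis

lemma C_diff_Suc_imp: "C_diff (Suc k) f \<Longrightarrow> C_diff k f"
proof (induction k arbitrary: f)
  case 0
  then show ?case
    by (auto simp: continuous_on_eq_continuous_at intro!: differentiable_imp_continuous_within)
next
  case (Suc k)
  then show ?case by simp
qed

lemma C_diff_const: "C_diff k (\<lambda>_. c)"
proof (induction k arbitrary: c)
  case 0
  show ?case by simp
next
  case (Suc k)
  have "partial_deriv i (\<lambda>_. c) = (\<lambda>_. 0)" for i
    by (rule ext, subst partial_deriv_eqI[of _ "\<lambda>_. 0"]) auto
  then show ?case using Suc by simp
qed

lemma C_diff_component: "C_diff k (\<lambda>x. x $ j)"
proof (cases k)
  case 0
  then show ?thesis by (simp add: continuous_on_component)
next
  case (Suc l)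
  have "partial_deriv i (\<lambda>x. x $ j) = (\<lambda>_. axis i 1 $ j)" for i
    by (rule ext, rule partial_deriv_eqI) (auto intro!: bounded_linear_imp_has_derivative bounded_linear_vec_nth)
  then show ?thesis using Suc by (simp add: C_diff_const bounded_linear_imp_differentiable bounded_linear_vec_nth)
qed

lemma C_diff_add: "C_diff k f \<Longrightarrow> C_diff k g \<Longrightarrow> C_diff k (\<lambda>x. f x + g x)"
proof (induction k arbitrary: f g)
  case 0
  then show ?case by (simp add: continuous_on_add)
next
  case (Suc k)
  have "partial_deriv i (\<lambda>x. f x + g x) = (\<lambda>x. partial_deriv i f x + partial_deriv i g x)" for i
  proof
    fix x
    have f: "(f has_derivative frechet_derivative f (at x)) (at x)"
      and g: "(g has_derivative frechet_derivative g (at x)) (at x)"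
      using Suc.prems by (simp_all flip: frechet_derivative_works)
    show "partial_deriv i (\<lambda>x. f x + g x) x = partial_deriv i f x + partial_deriv i g x"
      by (subst partial_deriv_eqI[OF has_derivative_add[OF f g]]) (simp add: partial_deriv_def)
  qed
  with Suc show ?case by simp
qed

lemma C_diff_mult: "C_diff k f \<Longrightarrow> C_diff k g \<Longrightarrow> C_diff k (\<lambda>x. f x * g x)"
proof (induction k arbitrary: f g)
  case 0
  then show ?case by (simp add: continuous_on_mult)
next
  case (Suc k)
  have "partial_deriv i (\<lambda>x. f x * g x) =
      (\<lambda>x. f x * partial_deriv i g x + partial_deriv i f x * g x)" for i
  proof
    fix x
    have f: "(f has_derivative frechet_derivative f (at x)) (at x)"
      and g: "(g has_derivative frechet_derivative g (at x)) (at x)"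
      using Suc.prems by (simp_all flip: frechet_derivative_works)
    show "partial_deriv i (\<lambda>x. f x * g x) x = f x * partial_deriv i g x + partial_deriv i f x * g x"
      by (subst partial_deriv_eqI[OF has_derivative_mult[OF f g]]) (simp add: partial_deriv_def)
  qed
  moreover have "C_diff k f" "C_diff k g"
    using Suc.prems by (auto intro: C_diff_Suc_imp)
  ultimately show ?case
    using Suc by (simp add: C_diff_add)
qed

lemma flat_fn_comp_has_derivative:
  assumes "h differentiable (at x)"
  shows "((\<lambda>x. flat_fn p (h x)) has_derivative
           (\<lambda>v. flat_fn (flat_deriv p) (h x) * frechet_derivative h (at x) v)) (at x)"
proof -
  have "(h has_derivative frechet_derivative h (at x)) (at x)"
    using assms by (simp flip: frechet_derivative_works)
  then show ?thesis
    by (rule has_derivative_compose)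
       (use flat_fn_has_derivative in \<open>auto simp: has_field_derivative_def\<close>)
qed

text \<open>The induction runs over all p at once, since each partial derivative replaces p by
  \<open>flat_deriv p\<close>. Smoothness of h of every order is assumed so that even the case of
  order 0 can use differentiability of h.\<close>

lemma C_diff_flat_fn_comp: "\<forall>k. C_diff k h \<Longrightarrow> C_diff k (\<lambda>x. flat_fn p (h x))"
proof (induction k arbitrary: p)
  case 0
  then have "h differentiable (at x)" for x
    by (auto dest: spec[of _ "Suc 0"])
  then have "(\<lambda>x. flat_fn p (h x)) differentiable (at x)" for x
    using flat_fn_comp_has_derivative differentiable_def by blast
  then show ?case
    by (auto simp: continuous_on_eq_continuous_at intro!: differentiable_imp_continuous_within)
next
  case (Suc k)
  have h: "h differentiable (at x)" "C_diff k (partial_deriv i h)" for x i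
    using Suc.prems by (auto dest: spec[of _ "Suc k"])
  have "partial_deriv i (\<lambda>x. flat_fn p (h x)) =
      (\<lambda>x. flat_fn (flat_deriv p) (h x) * partial_deriv i h x)" for i
    by (rule ext, subst partial_deriv_eqI[OF flat_fn_comp_has_derivative[OF h(1)]])
       (simp add: partial_deriv_def)
  moreover have "(\<lambda>x. flat_fn p (h x)) differentiable (at x)" for x
    using flat_fn_comp_has_derivative[OF h(1)] differentiable_def by blast
  ultimately show ?case
    using Suc h by (simp add: C_diff_mult)
qed

text \<open>The standard mollifier exp(-1/(1 - r^2)) with r = |x - x0|/\<epsilon>, left
  unnormalised. The squared distance is a polynomial in the coordinates, so no singularity arises at
  the centre.\<close>

definition bump :: "real^2 \<Rightarrow> real \<Rightarrow> real^2 \<Rightarrow> real" where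
  "bump x0 \<epsilon> x = flat_fn 1 (1 - (norm (x - x0) / \<epsilon>)\<^sup>2)"

text \<open>The radial factor of the gradient of the bump in the rescaled variable y = (x -
  x0)/\<epsilon>: the outer derivative in the chain rule. It does not depend on \<epsilon>.\<close>

definition bump_weight :: "real^2 \<Rightarrow> real" where
  "bump_weight y = flat_fn (flat_deriv 1) (1 - (norm y)\<^sup>2)"

lemma bump_le_1: "\<bar>bump x0 \<epsilon> x\<bar> \<le> 1"
  by (simp add: bump_def flat_fn_def)

lemma bump_eq_0_iff:
  assumes "\<epsilon> > 0"
  shows "bump x0 \<epsilon> x = 0 \<longleftrightarrow> x \<notin> ball x0 \<epsilon>"
  using assms abs_square_less_1[of "norm (x - x0) / \<epsilon>"]
  by (auto simp: bump_def flat_fn_def dist_norm norm_minus_commute)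

text \<open>Only constants, coordinates, sums and products occur inside \<open>flat_fn\<close>, so
  the closure rules for \<open>C_diff\<close> apply syntactically.\<close>

lemma bump_alt: "bump x0 \<epsilon> x =
    flat_fn 1 (1 + (- (1 / \<epsilon>\<^sup>2)) * ((x$1 + - x0$1) * (x$1 + - x0$1) + (x$2 + - x0$2) * (x$2 + - x0$2)))"
  by (simp add: bump_def power_divide power2_norm_eq_inner inner_vec_def sum_2)

lemma C_diff_bump: "C_diff k (bump x0 \<epsilon>)"
proof -
  have "C_diff k (\<lambda>x. flat_fn 1 (1 + (- (1 / \<epsilon>\<^sup>2)) * ((x$1 + - x0$1) * (x$1 + - x0$1) + (x$2 + - x0$2) * (x$2 + - x0$2))))"
    by (intro C_diff_flat_fn_comp allI C_diff_add C_diff_mult C_diff_const C_diff_component)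
  then show ?thesis by (simp add: bump_alt[abs_def])
qed

lemma grad_bump:
  assumes "\<epsilon> > 0"
  shows "grad (bump x0 \<epsilon>) (x0 + \<epsilon> *\<^sub>R y) = (- 2 / \<epsilon> * bump_weight y) *\<^sub>R y"
proof -
  let ?x = "x0 + \<epsilon> *\<^sub>R y"
  define h where "h = (\<lambda>x. 1 - ((x - x0) \<bullet> (x - x0)) / \<epsilon>\<^sup>2)"
  have b: "bump x0 \<epsilon> = (\<lambda>x. flat_fn 1 (h x))"
    by (simp add: bump_def h_def power_divide power2_norm_eq_inner fun_eq_iff)
  have h': "(h has_derivative (\<lambda>v. - (2 / \<epsilon>\<^sup>2 * ((x - x0) \<bullet> v)))) (at x)" for x
    unfolding h_def using assms by (auto intro!: derivative_eq_intros simp: inner_commute field_simps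
          power2_eq_square eval_nat_numeral)
  have hx: "h ?x = 1 - (norm y)\<^sup>2"
    using assms by (simp add: h_def power2_norm_eq_inner) (simp add: power2_eq_square)
  have "partial_deriv i (bump x0 \<epsilon>) ?x = bump_weight y * (- 2 / \<epsilon> * y $ i)" for i
  proof -
    have "((\<lambda>x. flat_fn 1 (h x)) has_derivative
           (\<lambda>v. flat_fn (flat_deriv 1) (h ?x) * frechet_derivative h (at ?x) v)) (at ?x)"
      using h' by (intro flat_fn_comp_has_derivative) (auto simp: differentiable_def)
    then have "partial_deriv i (bump x0 \<epsilon>) ?x =
        flat_fn (flat_deriv 1) (h ?x) * frechet_derivative h (at ?x) (axis i 1)"
      unfolding b by (rule partial_deriv_eqI)
    also have "frechet_derivative h (at ?x) = (\<lambda>v. - (2 / \<epsilon>\<^sup>2 * ((?x - x0) \<bullet> v)))"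
      by (rule frechet_derivative_at[OF h', symmetric])
    finally show ?thesis
      using assms by (simp add: hx bump_weight_def inner_axis power2_eq_square field_simps)
  qed
  then show ?thesis
    by (simp add: grad_def vec_eq_iff mult_ac)
qed

lemma bump_weight_nonneg: "bump_weight y \<ge> 0"
  by (simp add: bump_weight_def flat_fn_def flat_deriv_def poly_monom)

lemma bump_weight_pos_iff: "bump_weight y > 0 \<longleftrightarrow> y \<in> ball 0 1"
  using abs_square_less_1[of "norm y"]
  by (auto simp: bump_weight_def flat_fn_def flat_deriv_def poly_monom)

lemma continuous_on_flat_fn: "continuous_on UNIV (flat_fn p)"
  by (meson DERIV_isCont continuous_at_imp_continuous_on flat_fn_has_derivative)

lemma continuous_on_bump_weight: "continuous_on UNIV bump_weight"
  unfolding bump_weight_def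
  by (rule continuous_on_compose2[OF continuous_on_flat_fn]) (auto intro!: continuous_intros)

lemma test_function_bump:
  assumes "\<epsilon> > 0" "cball x0 \<epsilon> \<subseteq> \<Omega>"
  shows "test_function \<Omega> (bump x0 \<epsilon>)"
proof -
  have "{x. bump x0 \<epsilon> x \<noteq> 0} = ball x0 \<epsilon>"
    using assms by (auto simp: bump_eq_0_iff)
  then show ?thesis
    using assms C_diff_bump by (simp add: test_function_def)
qed

section \<open>Triangles sharing an edge\<close>

lemma diameter_closed_segment:
  fixes a b :: "'a::euclidean_space"
  shows "diameter (closed_segment a b) = dist a b"
proof (rule antisym)
  have "norm (x - y) \<le> dist a b" if "x \<in> closed_segment a b" "y \<in> closed_segment a b" for x y
  proof -
    have "closed_segment x y \<subseteq> closed_segment a b"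
      using that by (simp add: subset_closed_segment)
    then have "norm (x - y) \<le> max (norm (x - a)) (norm (x - b))"
      using that segment_furthest_le[of y a b x]
      by (auto simp: max_def)
    also have "\<dots> \<le> dist a b"
      using dist_in_closed_segment[OF that(1)] by (simp add: dist_norm)
    finally show ?thesis .
  qed
  then show "diameter (closed_segment a b) \<le> dist a b"
    by (intro diameter_le) auto
  show "dist a b \<le> diameter (closed_segment a b)"
    by (intro diameter_bounded_bound) (auto simp: compact_imp_bounded)
qed

text \<open>\<open>edge_integral\<close> is a definite description over all ways of writing E as a
  segment, so every pair of endpoints has to give the same number. Expressing the length as a
  diameter makes this visible, as it depends on E alone.\<close>

lemma edge_integral_const:
  assumes "E = closed_segment a b" "\<And>x. x \<in> E \<Longrightarrow> f x = c"
  shows "edge_integral E f = edge_length E * c"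
proof -
  have *: "dist p q * integral {0..1} (\<lambda>t. f (linepath p q t)) = edge_length E * c"
    if "E = closed_segment p q" for p q
  proof -
    have "integral {0..1} (\<lambda>t. f (linepath p q t)) = integral {0..1} (\<lambda>_::real. c)"
      using that assms(2) by (intro integral_cong) (auto simp: linepath_in_path)
    then show ?thesis
      using that by (simp only: diameter_closed_segment) simp
  qed
  show ?thesis
    unfolding edge_integral_def
  proof (rule the_equality)
    show "\<exists>a b. E = closed_segment a b \<and>
        edge_length E * c = dist a b * integral {0..1} (\<lambda>t. f (linepath a b t))"
      by (rule exI[of _ a], rule exI[of _ b], simp only: *[OF assms(1)] assms(1)[symmetric])
  next
    fix I assume "\<exists>a b. E = closed_segment a b \<and>
        I = dist a b * integral {0..1} (\<lambda>t. f (linepath a b t))"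
    then obtain p q where "E = closed_segment p q"
      "I = dist p q * integral {0..1} (\<lambda>t. f (linepath p q t))" by (elim exE conjE)
    then show "I = edge_length E * c" by (simp only: *)
  qed
qed

section \<open>Orthonormal frames in the plane\<close>

lemma orthogonal_decomposition_plane:
  fixes n :: "real^2"
  assumes "norm n = 1"
  obtains J where "\<And>x. x = (x \<bullet> n) *\<^sub>R n + (x \<bullet> J) *\<^sub>R J" "norm J = 1" "n \<bullet> J = 0"
proof
  \<comment> \<open>n rotated by a quarter turn.\<close>
  let ?J = "vector [- n$2, n$1] :: real^2"
  have n: "(n$1)\<^sup>2 + (n$2)\<^sup>2 = 1"
    using assms by (simp add: norm_eq_sqrt_inner inner_vec_def sum_2 power2_eq_square)
  show "norm ?J = 1"
    using n by (simp add: norm_eq_sqrt_inner inner_vec_def sum_2 power2_eq_square)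
  show "n \<bullet> ?J = 0"
    by (simp add: inner_vec_def sum_2)
  show "x = (x \<bullet> n) *\<^sub>R n + (x \<bullet> ?J) *\<^sub>R ?J" for x
  proof -
    have "((x \<bullet> n) *\<^sub>R n + (x \<bullet> ?J) *\<^sub>R ?J) $ i = x $ i * ((n$1)\<^sup>2 + (n$2)\<^sup>2)" for i
      using exhaust_2[of i]
      by (auto simp: inner_vec_def sum_2 power2_eq_square algebra_simps)
    then show ?thesis
      by (simp add: vec_eq_iff n)
  qed
qed

text \<open>Both e and d are multiples of the unit vector J orthogonal to n, so their inner product
  is the product of the two coefficients.\<close>

lemma orthogonal_to_basis_eq_0:
  fixes n e d :: "real^2"
  assumes "norm n = 1" "n \<bullet> e = 0" "e \<noteq> 0" "d \<bullet> n = 0" "d \<bullet> e = 0"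
  shows "d = 0"
proof -
  obtain J where J: "\<And>x. x = (x \<bullet> n) *\<^sub>R n + (x \<bullet> J) *\<^sub>R J"
    by (rule orthogonal_decomposition_plane[OF assms(1)]) blast
  have e: "e = (e \<bullet> J) *\<^sub>R J" and d: "d = (d \<bullet> J) *\<^sub>R J"
    using J[of e] J[of d] assms by (auto simp: inner_commute)
  have "(e \<bullet> J) * (d \<bullet> J) = d \<bullet> e"
    by (subst (2) e) (simp add: inner_commute)
  with assms have "e \<bullet> J = 0 \<or> d \<bullet> J = 0" by simp
  with e d assms show ?thesis by auto
qed

lemma normal_eq_or_opposite:
  fixes n \<nu> e :: "real^2"
  assumes "norm n = 1" "n \<bullet> e = 0" "e \<noteq> 0" "norm \<nu> = 1" "\<nu> \<bullet> e = 0"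
  shows "\<nu> = n \<or> \<nu> = - n"
proof -
  have "\<nu> - (\<nu> \<bullet> n) *\<^sub>R n = 0"
    using assms by (intro orthogonal_to_basis_eq_0[OF assms(1-3)])
      (auto simp: inner_diff_left dot_square_norm)
  then have \<nu>: "\<nu> = (\<nu> \<bullet> n) *\<^sub>R n" by simp
  then have "norm \<nu> = \<bar>\<nu> \<bullet> n\<bar> * norm n" by (metis norm_scaleR)
  then have "\<nu> \<bullet> n = 1 \<or> \<nu> \<bullet> n = - 1" using assms by auto
  then show ?thesis using \<nu> by auto
qed

section \<open>Interiors and faces of triangles\<close>

lemma simplex_interior_nonempty:
  fixes K :: "(real^2) set"
  assumes "2 simplex K"
  shows "interior K \<noteq> {}"
  using assms interior_convex_hull_eq_empty[where 'a="real^2"]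
  by (auto simp: simplex_def)

lemma simplex_compact_convex: "n simplex K \<Longrightarrow> compact K" "n simplex K \<Longrightarrow> convex K"
  by (auto dest!: simplex_imp_polytope simp: polytope_imp_compact polytope_imp_convex)

text \<open>The intersection is a face of both triangles. A proper face has dimension below 2, while
  a set with interior points has dimension 2, so the intersection would be equal to each of the
  two.\<close>

lemma triangulation_interior_Int:
  fixes T :: "(real^2) set set"
  assumes "triangulation T" "K \<in> T" "K' \<in> T" "K \<noteq> K'" "2 simplex K" "2 simplex K'"
  shows "interior (K \<inter> K') = {}"
proof (rule ccontr)
  assume ne: "interior (K \<inter> K') \<noteq> {}"
  have *: "A \<inter> B = A" if "A \<in> T" "B \<in> T" "2 simplex A" "interior (A \<inter> B) \<noteq> {}" for A B
  proof (rule ccontr)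
    assume "A \<inter> B \<noteq> A"
    moreover have "A \<inter> B face_of A"
      using assms(1) that by (auto simp: triangulation_def)
    ultimately have "aff_dim (A \<inter> B) < aff_dim A"
      using that by (intro face_of_aff_dim_lt) (auto simp: simplex_compact_convex)
    moreover have "aff_dim (A \<inter> B) = 2"
      using aff_dim_nonempty_interior[OF that(4)] by simp
    ultimately show False
      using aff_dim_simplex[OF that(3)] by simp
  qed
  from *[of K K'] *[of K' K] assms ne show False
    by (simp add: Int_commute)
qed

text \<open>Faces of the hull of affinely independent points are the hulls of subsets, and dimension
  1 forces a subset of two points.\<close>

lemma triangle_edge_vertices:
  fixes K :: "(real^2) set"
  assumes "2 simplex K" "E edge_of K"
  obtains a b c where "\<not> collinear {a, b, c}" "K = convex hull {a, b, c}" "E = closed_segment a b"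
proof -
  obtain C where C: "finite C" "\<not> affine_dependent C" "card C = 3" "K = convex hull C"
    using assms(1) by (auto simp: simplex)
  obtain D where D: "D \<subseteq> C" "E = convex hull D"
    using assms(2) C by (auto simp: edge_of_def face_of_convex_hull_affine_independent)
  have "\<not> affine_dependent D" "finite D"
    using C D affine_independent_subset finite_subset by blast+
  then have "of_nat (card D) = aff_dim E + 1"
    using D by (simp add: aff_dim_affine_independent aff_dim_convex_hull)
  then have "card D = 2"
    using assms(2) by (simp add: edge_of_def)
  then obtain a b where ab: "D = {a, b}" "a \<noteq> b"
    by (meson card_2_iff)
  have "card (C - D) = 1"
    using C D \<open>card D = 2\<close> \<open>finite D\<close> by (simp add: card_Diff_subset)
  then obtain c where "C - D = {c}"
    by (meson card_1_singletonE)
  then have C': "C = {a, b, c}" "c \<noteq> a" "c \<noteq> b"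
    using D ab by auto
  show thesis
  proof
    show "\<not> collinear {a, b, c}"
      using C C' ab by (simp add: collinear_3_eq_affine_dependent)
    show "K = convex hull {a, b, c}" using C C' by simp
    show "E = closed_segment a b" using D ab by (simp add: segment_convex_hull)
  qed
qed

section \<open>Outward normals and half discs at edge midpoints\<close>

lemma triangle_normal_exists:
  fixes a b c :: "real^2"
  assumes "\<not> collinear {a, b, c}"
  obtains n where "norm n = 1" "n \<bullet> (b - a) = 0" "n \<bullet> (c - a) < 0"
proof -
  let ?e = "b - a"
  have "?e \<noteq> 0"
    using assms by auto
  define J where "J = (1 / norm ?e) *\<^sub>R ?e"
  have "norm J = 1"
    using \<open>?e \<noteq> 0\<close> by (simp add: J_def)
  then obtain n where n: "\<And>x. x = (x \<bullet> J) *\<^sub>R J + (x \<bullet> n) *\<^sub>R n" "norm n = 1" "J \<bullet> n = 0"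
    by (rule orthogonal_decomposition_plane[of J]) blast
  have ne: "n \<bullet> ?e = 0"
    using n(3) \<open>?e \<noteq> 0\<close> by (simp add: J_def inner_commute)
  have "n \<bullet> (c - a) \<noteq> 0"
  proof
    assume "n \<bullet> (c - a) = 0"
    then have "c - a = ((c - a) \<bullet> J) *\<^sub>R J"
      using n(1)[of "c - a"] by (simp add: inner_commute)
    then have "c - a = (((c - a) \<bullet> J) / norm ?e) *\<^sub>R ?e"
      by (simp add: J_def)
    then have "collinear {0, ?e, c - a}"
      unfolding collinear_lemma by blast
    then have "collinear {b, a, c}"
      by (simp add: collinear_3)
    then show False
      using assms by (simp add: insert_commute)
  qed
  then show thesis
    using that[of n] that[of "- n"] n(2) ne by fastforce
qed

text \<open>For uniqueness, testing with the two endpoints in both orders makes a candidate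
  orthogonal to the edge, which leaves n and -n; the third vertex c decides the sign.\<close>

lemma outward_normal_triangle:
  fixes a b c :: "real^2"
  assumes "norm n = 1" "n \<bullet> (b - a) = 0" "n \<bullet> (c - a) < 0"
    and K: "K = convex hull {a, b, c}" and E: "E = closed_segment a b" and "a \<noteq> b"
  shows "outward_normal K E = n"
  unfolding outward_normal_def
proof (rule the_equality)
  have "n \<bullet> b = n \<bullet> a" "n \<bullet> c \<le> n \<bullet> a"
    using assms(2,3) by (auto simp: inner_diff_right)
  then have "convex hull {a, b, c} \<subseteq> {y. n \<bullet> y \<le> n \<bullet> a}" "convex hull {a, b} \<subseteq> {x. n \<bullet> x = n \<bullet> a}"
    by (simp_all add: subset_hull convex_halfspace_le convex_hyperplane)
  then have "\<forall>y\<in>K. n \<bullet> y \<le> n \<bullet> a" "\<forall>x\<in>E. n \<bullet> x = n \<bullet> a"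
    unfolding K E segment_convex_hull by blast+
  then show "norm n = 1 \<and> (\<forall>x\<in>E. \<forall>y\<in>K. n \<bullet> (y - x) \<le> 0)"
    using assms(1) by (simp add: inner_diff_right)
next
  fix \<nu> assume \<nu>: "norm \<nu> = 1 \<and> (\<forall>x\<in>E. \<forall>y\<in>K. \<nu> \<bullet> (y - x) \<le> 0)"
  have "a \<in> E" "b \<in> E"
    unfolding E by simp_all
  moreover have "a \<in> K" "b \<in> K" "c \<in> K"
    unfolding K by (simp_all add: hull_inc)
  ultimately have *: "\<nu> \<bullet> (b - a) \<le> 0" "\<nu> \<bullet> (a - b) \<le> 0" "\<nu> \<bullet> (c - a) \<le> 0"
    using \<nu> by blast+
  then have "\<nu> \<bullet> (b - a) = 0"
    by (simp add: inner_diff_right)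
  then have "\<nu> = n \<or> \<nu> = - n"
    using assms(1,2,6) \<nu> by (intro normal_eq_or_opposite[of n "b - a"]) simp_all
  then show "\<nu> = n"
    using *(3) assms(3) by auto
qed

text \<open>At the midpoint the barycentric coordinates of a and b are 1/2, so they stay positive
  nearby by continuity. The coordinate of c vanishes there, and its sign is exactly the half-plane
  condition.\<close>

lemma triangle_contains_half_disc:
  fixes a b c :: "real^2"
  assumes "norm n = 1" "n \<bullet> (b - a) = 0" "n \<bullet> (c - a) < 0" "a \<noteq> b"
  obtains \<delta> where "\<delta> > 0"
    "\<And>x. dist (midpoint a b) x < \<delta> \<Longrightarrow> n \<bullet> (x - midpoint a b) \<le> 0 \<Longrightarrow> x \<in> convex hull {a, b, c}"
proof -
  let ?e = "b - a" and ?m = "midpoint a b"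
  \<comment> \<open>The coordinates in x - a = s (b - a) + t (c - a): pairing with n, which is
    orthogonal to b - a, isolates t, and pairing with b - a then gives s.\<close>
  define t where "t = (\<lambda>x. n \<bullet> (x - a) / (n \<bullet> (c - a)))"
  define s where "s = (\<lambda>x. ((x - a) \<bullet> ?e - t x * ((c - a) \<bullet> ?e)) / (?e \<bullet> ?e))"
  have m: "?m - a = (1/2) *\<^sub>R ?e"
    by (simp add: midpoint_def vec_eq_iff)
  have nm: "n \<bullet> (?m - a) = 0" using m assms by simp
  have "isCont t ?m"
    using assms unfolding t_def by (intro continuous_intros) auto
  moreover from this have "isCont s ?m"
    using assms unfolding s_def by (intro continuous_intros) auto
  moreover have tm: "t ?m = 0" using nm by (simp add: t_def)
  moreover have sm: "s ?m = 1/2"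
    using assms(4) unfolding s_def tm m by simp
  ultimately have "(s \<longlongrightarrow> 1/2) (at ?m)" "((\<lambda>x. s x + t x) \<longlongrightarrow> 1/2 + 0) (at ?m)"
    using tendsto_add[of s "1/2" "at ?m" t 0] by (auto simp: isCont_def)
  then have "\<forall>\<^sub>F x in at ?m. 0 < s x" "\<forall>\<^sub>F x in at ?m. s x + t x < 1"
    by (auto intro: order_tendstoD)
  then have "\<forall>\<^sub>F x in at ?m. 0 < s x \<and> s x + t x < 1"
    by (rule eventually_conj)
  then obtain \<delta> where \<delta>: "\<delta> > 0"
    "\<And>x. x \<noteq> ?m \<Longrightarrow> dist x ?m < \<delta> \<Longrightarrow> 0 < s x \<and> s x + t x < 1"
    unfolding eventually_at by blast
  show thesis
  proof
    fix x assume x: "dist ?m x < \<delta>" "n \<bullet> (x - ?m) \<le> 0"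
    have st: "0 < s x \<and> s x + t x < 1"
      using \<delta>(2)[of x] x sm tm by (cases "x = ?m") (auto simp: dist_commute)
    have "n \<bullet> (x - a) \<le> 0"
      using x nm by (simp add: inner_diff_right)
    then have t0: "t x \<ge> 0"
      using assms by (auto simp: t_def divide_nonpos_neg)
    define d where "d = (x - a) - s x *\<^sub>R ?e - t x *\<^sub>R (c - a)"
    have "d \<bullet> n = n \<bullet> (x - a) - s x * (n \<bullet> ?e) - t x * (n \<bullet> (c - a))"
      by (simp only: d_def inner_commute[of n] inner_diff_left inner_scaleR_left)
    also have "\<dots> = 0"
      using assms(2,3) unfolding t_def by simp
    finally have "d \<bullet> n = 0" .
    moreover have "d \<bullet> ?e = 0"
    proof -
      have "d \<bullet> ?e = (x - a) \<bullet> ?e - s x * (?e \<bullet> ?e) - t x * ((c - a) \<bullet> ?e)"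
        by (simp only: d_def inner_diff_left[where z = ?e] inner_scaleR_left)
      also have "s x * (?e \<bullet> ?e) = (x - a) \<bullet> ?e - t x * ((c - a) \<bullet> ?e)"
        using assms(4) unfolding s_def by simp
      finally show ?thesis by simp
    qed
    ultimately have "d = 0"
      using assms by (intro orthogonal_to_basis_eq_0[of n ?e]) auto
    then have "x = a + s x *\<^sub>R (b - a) + t x *\<^sub>R (c - a)"
      by (simp add: d_def algebra_simps)
    also have "\<dots> = (1 - s x - t x) *\<^sub>R a + s x *\<^sub>R b + t x *\<^sub>R c"
      by (simp add: algebra_simps)
    finally show "x \<in> convex hull {a, b, c}"
      using st t0 unfolding convex_hull_3
      by (intro CollectI exI[of _ "1 - s x - t x"] exI[of _ "s x"] exI[of _ "t x"]) auto
  qed fact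
qed

lemma triangle_near_edge:
  fixes K :: "(real^2) set"
  assumes "2 simplex K" "E edge_of K"
  obtains a b n \<delta> where "E = closed_segment a b" "a \<noteq> b" "outward_normal K E = n" "norm n = 1"
    "n \<bullet> (b - a) = 0" "\<delta> > 0"
    "\<And>x. dist (midpoint a b) x < \<delta> \<Longrightarrow> n \<bullet> (x - midpoint a b) \<le> 0 \<Longrightarrow> x \<in> K"
proof -
  obtain a b c where abc: "\<not> collinear {a, b, c}" "K = convex hull {a, b, c}" "E = closed_segment a b"
    using triangle_edge_vertices[OF assms] .
  then have "a \<noteq> b" by auto
  obtain n where n: "norm n = 1" "n \<bullet> (b - a) = 0" "n \<bullet> (c - a) < 0"
    using triangle_normal_exists[OF abc(1)] .
  obtain \<delta> where "\<delta> > 0"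
    "\<And>x. dist (midpoint a b) x < \<delta> \<Longrightarrow> n \<bullet> (x - midpoint a b) \<le> 0 \<Longrightarrow> x \<in> convex hull {a, b, c}"
    by (rule triangle_contains_half_disc[OF n \<open>a \<noteq> b\<close>]) blast
  then show thesis
    using that[of a b n \<delta>] abc n \<open>a \<noteq> b\<close> outward_normal_triangle[OF n abc(2,3)] by simp
qed

text \<open>Both triangles fill a half disc at the same midpoint. The normals agree up to sign;
  equal signs would put both half discs on the same side, so that the triangles would overlap in an
  open set.\<close>

lemma shared_edge_neighbourhood:
  fixes T :: "(real^2) set set"
  assumes T: "triangulation T" "K \<in> T" "K' \<in> T" "K \<noteq> K'" "2 simplex K" "2 simplex K'"
    and E: "E edge_of K" "E edge_of K'"
  obtains x0 n \<delta> where "x0 \<in> E" "norm n = 1" "\<delta> > 0" "outward_normal K E = n" "outward_normal K' E = - n"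
    "\<And>x. dist x0 x < \<delta> \<Longrightarrow> n \<bullet> (x - x0) \<le> 0 \<Longrightarrow> x \<in> K"
    "\<And>x. dist x0 x < \<delta> \<Longrightarrow> n \<bullet> (x - x0) \<ge> 0 \<Longrightarrow> x \<in> K'"
proof -
  obtain a b n \<delta> where *: "E = closed_segment a b" "a \<noteq> b" "outward_normal K E = n" "norm n = 1"
    "n \<bullet> (b - a) = 0" "\<delta> > 0"
    "\<And>x. dist (midpoint a b) x < \<delta> \<Longrightarrow> n \<bullet> (x - midpoint a b) \<le> 0 \<Longrightarrow> x \<in> K"
    by (rule triangle_near_edge[OF T(5) E(1)]) blast
  obtain a' b' n' \<delta>' where **: "E = closed_segment a' b'" "a' \<noteq> b'" "outward_normal K' E = n'"
    "norm n' = 1" "n' \<bullet> (b' - a') = 0" "\<delta>' > 0"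
    "\<And>x. dist (midpoint a' b') x < \<delta>' \<Longrightarrow> n' \<bullet> (x - midpoint a' b') \<le> 0 \<Longrightarrow> x \<in> K'"
    by (rule triangle_near_edge[OF T(6) E(2)]) blast
  let ?m = "midpoint a b" and ?\<delta> = "min \<delta> \<delta>'"
  \<comment> \<open>The two descriptions of E may list its endpoints in different orders; the
    midpoint does not depend on the order.\<close>
  have "{a, b} = {a', b'}"
    using * ** by (metis closed_segment_eq)
  then have ab: "a' = a \<and> b' = b \<or> a' = b \<and> b' = a"
    by (auto simp: doubleton_eq_iff)
  then have m: "midpoint a' b' = ?m"
    by (auto simp: midpoint_sym)
  have "n' \<bullet> (b - a) = 0"
    using ab **(5) by (auto simp: inner_diff_right)
  then have "n' = n \<or> n' = - n"
    using * ** by (intro normal_eq_or_opposite[of n "b - a"]) auto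
  moreover have "n' \<noteq> n"
  proof
    assume "n' = n"
    define y where "y = ?m - (?\<delta> / 2) *\<^sub>R n"
    let ?U = "ball ?m ?\<delta> \<inter> {x. n \<bullet> x < n \<bullet> ?m}"
    have "y \<in> ?U"
    proof -
      have "0 < ?\<delta>" using * ** by simp
      then have "?\<delta> / 2 < ?\<delta>" by linarith
      with \<open>0 < ?\<delta>\<close> show ?thesis
        using *(4) by (simp add: y_def dist_norm inner_diff_right dot_square_norm del: min_less_iff_conj)
    qed
    moreover have "?U \<subseteq> K \<inter> K'"
      using *(7) **(7) \<open>n' = n\<close> m by (auto simp: inner_diff_right)
    moreover have "open ?U"
      by (intro open_Int open_ball open_halfspace_lt)
    ultimately have "interior (K \<inter> K') \<noteq> {}"
      using interior_maximal[of ?U "K \<inter> K'"] by blast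
    then show False
      using triangulation_interior_Int[OF T] by simp
  qed
  ultimately have "n' = - n" by simp
  show thesis
  proof
    show "?m \<in> E" using * by simp
    show "?\<delta> > 0" using * ** by simp
    show "outward_normal K' E = - n" using ** \<open>n' = - n\<close> by simp
    show "\<And>x. dist ?m x < ?\<delta> \<Longrightarrow> n \<bullet> (x - ?m) \<ge> 0 \<Longrightarrow> x \<in> K'"
      using **(7) m \<open>n' = - n\<close> by simp
  qed (use * in auto)
qed

text \<open>A nonempty open set is not negligible. This turns almost-everywhere identities into
  statements at a point, on which uniqueness of the values from inside a triangle rests.\<close>

lemma AE_on_nonempty_interior_imp_Ex:
  assumes "AE x\<in>K in lebesgue. P x" "interior K \<noteq> {}"
  obtains x where "x \<in> interior K" "P x"
proof (rule ccontr)
  assume "\<not> thesis"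
  with that have "x \<in> interior K \<Longrightarrow> \<not> P x" for x by blast
  moreover obtain N where "N \<in> null_sets lebesgue" "\<And>x. x \<in> space lebesgue - N \<Longrightarrow> x \<in> K \<longrightarrow> P x"
    by (rule AE_E3[OF assms(1)]) blast
  ultimately have "interior K \<subseteq> N"
    using interior_subset by auto
  then have "negligible (interior K)"
    using \<open>N \<in> null_sets lebesgue\<close> negligible_iff_null_sets negligible_subset by metis
  then show False
    using open_not_negligible assms(2) by blast
qed

section \<open>Uniqueness of constants and polynomials given almost everywhere\<close>

lemma cell_value_eqI:
  assumes "AE x\<in>K in lebesgue. q x = c" "interior K \<noteq> {}"
  shows "cell_value K q = c"
  unfolding cell_value_def
proof (rule the_equality)
  fix c' assume "AE x\<in>K in lebesgue. q x = c'"
  with assms(1) have "AE x\<in>K in lebesgue. q x = c \<and> q x = c'"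
    by eventually_elim auto
  then show "c' = c"
    using assms(2) by (rule AE_on_nonempty_interior_imp_Ex) auto
qed fact

lemma affine_field_eq_0:
  fixes a :: "real^2"
  assumes "open U" "U \<noteq> {}" "\<And>x. x \<in> U \<Longrightarrow> a + b *\<^sub>R x = 0"
  shows "a = 0" "b = 0"
proof -
  obtain x e where x: "x \<in> U" "e > 0" "ball x e \<subseteq> U"
    using assms by (meson all_not_in_conv openE)
  define y where "y = x + (e/2) *\<^sub>R axis 1 1"
  have "y \<in> U"
    using x by (intro subsetD[OF x(3)]) (simp add: y_def dist_norm norm_axis_1)
  then have "b *\<^sub>R (y - x) = 0"
    using assms(3)[of x] assms(3)[of y] x by (metis add_diff_cancel_left diff_0_right scaleR_right_diff_distrib)
  then show "b = 0"
    using x by (simp add: y_def)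
  with assms(3) x show "a = 0" by auto
qed

text \<open>By continuity the points of the interior where two such polynomials differ form an open
  set; it is null, hence empty. An affine field a + b x that vanishes on a nonempty open set has a =
  0 and b = 0.\<close>

lemma cell_field_eqI:
  assumes p: "p \<in> RT0" "AE x\<in>K in lebesgue. v x = p x" and K: "interior K \<noteq> {}"
  shows "cell_field K v = p"
  unfolding cell_field_def
proof (rule the_equality)
  fix p' assume p': "p' \<in> RT0 \<and> (AE x\<in>K in lebesgue. v x = p' x)"
  obtain a b a' b' where ab: "p = (\<lambda>x. a + b *\<^sub>R x)" "p' = (\<lambda>x. a' + b' *\<^sub>R x)"
    using p p' by (auto simp: RT0_def)
  have ae: "AE x\<in>K in lebesgue. p x = p' x"
    using p(2) p'[THEN conjunct2] by eventually_elim auto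
  let ?U = "interior K \<inter> {x. p x \<noteq> p' x}"
  have "open ?U"
    unfolding ab by (intro open_Int open_interior open_Collect_neq continuous_intros)
  have "AE x\<in>?U in lebesgue. p x = p' x"
    using ae by eventually_elim (use interior_subset in auto)
  have "?U = {}"
  proof (rule ccontr)
    assume "?U \<noteq> {}"
    with \<open>open ?U\<close> have "interior ?U \<noteq> {}"
      by (simp add: interior_open del: interior_Int)
    with \<open>AE x\<in>?U in lebesgue. p x = p' x\<close> show False
    proof (rule AE_on_nonempty_interior_imp_Ex)
      fix x assume "x \<in> interior ?U" "p x = p' x"
      then show False using interior_subset[of ?U] by blast
    qed
  qed
  then have "x \<in> interior K \<Longrightarrow> (a' - a) + (b' - b) *\<^sub>R x = 0" for x
    by (auto simp: ab algebra_simps)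
  then have "a' - a = 0" "b' - b = 0"
    using affine_field_eq_0[OF open_interior K, of "a' - a" "b' - b"] by blast+
  then show "p' = p" using ab by simp
qed (use p in simp)

section \<open>Continuity of the normal component\<close>

text \<open>Boxes determine Lebesgue measure, and the preimage of a box is its image under the
  inverse map, which is again orthogonal and so preserves measure.\<close>

lemma lborel_distr_orthogonal_transformation:
  fixes f :: "real^'n::{finite,wellorder} \<Rightarrow> real^'n::_"
  assumes "orthogonal_transformation f"
  shows "distr lborel borel f = lborel"
proof (rule lborel_eqI[symmetric])
  have "continuous_on UNIV f"
    using orthogonal_transformation_linear[OF assms(1)]
    unfolding linear_conv_bounded_linear by (rule linear_continuous_on)
  then have [measurable]: "f \<in> borel_measurable borel"
    by (rule borel_measurable_continuous_onI)
  fix l u :: "real^'n::_"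
  assume le: "\<And>b. b \<in> Basis \<Longrightarrow> l \<bullet> b \<le> u \<bullet> b"
  have inv: "orthogonal_transformation (inv f)"
    using assms by (rule orthogonal_transformation_inv)
  have "bij f"
    using assms by (rule orthogonal_transformation_bij)
  have img: "f -` box l u = inv f ` box l u"
    by (rule bij_vimage_eq_inv_image[OF \<open>bij f\<close>])
  have borel: "f -` box l u \<in> sets borel"
    using measurable_sets[of f borel borel "box l u"] by simp
  have lm: "f -` box l u \<in> lmeasurable"
    unfolding img by (rule measurable_orthogonal_image[OF inv]) simp
  have "emeasure (distr lborel borel f) (box l u) = emeasure lebesgue (f -` box l u)"
    using borel by (simp add: emeasure_distr)
  also have "\<dots> = ennreal (measure lebesgue (f -` box l u))"
    using lm by (rule emeasure_eq_measure2)
  also have "measure lebesgue (f -` box l u) = measure lebesgue (box l u)"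
    unfolding img by (rule measure_orthogonal_image[OF inv]) simp
  also have "\<dots> = (\<Prod>b\<in>Basis. (u - l) \<bullet> b)"
    using le by (simp add: measure_lborel_box_eq)
  finally show "emeasure (distr lborel borel f) (box l u) = ennreal (\<Prod>b\<in>Basis. (u - l) \<bullet> b)" .
qed simp

lemma integral_orthogonal_transformation:
  fixes f :: "real^'n::{finite,wellorder} \<Rightarrow> real^'n::_" and g :: "real^'n::_ \<Rightarrow> real"
  assumes "orthogonal_transformation f" "g \<in> borel_measurable borel"
  shows "(\<integral>x. g (f x) \<partial>lborel) = (\<integral>x. g x \<partial>lborel)"
proof -
  have "continuous_on UNIV f"
    using orthogonal_transformation_linear[OF assms(1)]
    unfolding linear_conv_bounded_linear by (rule linear_continuous_on)
  then have "f \<in> borel_measurable borel"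
    by (rule borel_measurable_continuous_onI)
  then have "(\<integral>x. g (f x) \<partial>lborel) = (\<integral>x. g x \<partial>distr lborel borel f)"
    using assms(2) by (simp add: integral_distr)
  then show ?thesis
    by (simp add: lborel_distr_orthogonal_transformation[OF assms(1)])
qed

section \<open>Rescaling of integrals and integrals against the bump weight\<close>

lemma integral_affine_plane:
  fixes g :: "real^2 \<Rightarrow> real"
  assumes "c > 0" "g \<in> borel_measurable borel"
  shows "(\<integral>x. g x \<partial>lborel) = c\<^sup>2 * (\<integral>y. g (t + c *\<^sub>R y) \<partial>lborel)"
proof -
  have "(\<integral>x. g x \<partial>lborel) = (\<integral>x. g x \<partial>density (distr lborel borel (\<lambda>x. t + c *\<^sub>R x)) (\<lambda>_. \<bar>c\<bar>^DIM(real^2)))"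
    using assms lborel_affine[of c t] by simp
  also have "\<dots> = (\<integral>x. c\<^sup>2 *\<^sub>R g x \<partial>distr lborel borel (\<lambda>x. t + c *\<^sub>R x))"
    using assms by (subst integral_density) auto
  also have "\<dots> = (\<integral>y. c\<^sup>2 *\<^sub>R g (t + c *\<^sub>R y) \<partial>lborel)"
    using assms by (subst integral_distr) auto
  finally show ?thesis by simp
qed

lemma borel_measurable_bump_weight [measurable]: "bump_weight \<in> borel_measurable borel"
  using continuous_on_bump_weight by (rule borel_measurable_continuous_onI)

lemma bump_weight_eq_0: "y \<notin> ball 0 1 \<Longrightarrow> bump_weight y = 0"
  using bump_weight_pos_iff[of y] bump_weight_nonneg[of y] by linarith

lemma integrable_bump_weight_mult:
  fixes g :: "real^2 \<Rightarrow> real"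
  assumes [measurable]: "g \<in> borel_measurable borel" and M: "\<And>y. norm y < 1 \<Longrightarrow> \<bar>g y\<bar> \<le> M"
  shows "integrable lborel (\<lambda>y. bump_weight y * g y)"
proof -
  have "compact (bump_weight ` cball 0 1)"
    by (intro compact_continuous_image continuous_on_subset[OF continuous_on_bump_weight]) auto
  then obtain B where B: "\<And>y. y \<in> cball 0 1 \<Longrightarrow> norm (bump_weight y) \<le> B"
    by (meson bounded_iff compact_imp_bounded imageI)
  have "integrable lborel (\<lambda>y. indicator (ball 0 1) y *\<^sub>R (bump_weight y * g y))"
  proof (rule integrableI_bounded_set_indicator[where B = "B * M"])
    show "AE y in lborel. y \<in> ball 0 1 \<longrightarrow> norm (bump_weight y * g y) \<le> B * M"
    proof (intro AE_I2 impI)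
      fix y :: "real^2" assume y: "y \<in> ball 0 1"
      then have "norm (bump_weight y) \<le> B" using B by simp
      with y M show "norm (bump_weight y * g y) \<le> B * M"
        unfolding norm_mult by (intro mult_mono) (auto intro: order_trans[OF norm_ge_zero])
    qed
    show "emeasure lborel (ball 0 1 :: (real^2) set) < \<infinity>"
      using emeasure_lborel_ball_finite[of "0 :: real^2" 1] by (simp add: top.not_eq_extremum)
  qed auto
  also have "(\<lambda>y. indicator (ball 0 1) y *\<^sub>R (bump_weight y * g y)) = (\<lambda>y. bump_weight y * g y)"
    by (auto simp: fun_eq_iff indicator_def bump_weight_eq_0)
  finally show ?thesis .
qed

text \<open>This integral is the factor of the jump in \<open>integral_half_plane_field\<close>; its
  positivity allows the jump to be read off from a vanishing integral.\<close>

lemma integral_bump_weight_pos: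
  assumes "norm n = 1"
  shows "(\<integral>y. bump_weight y * \<bar>n \<bullet> y\<bar> \<partial>lborel) > 0"
proof -
  have int: "integrable lborel (\<lambda>y. bump_weight y * \<bar>n \<bullet> y\<bar>)"
  proof (rule integrable_bump_weight_mult[where M = 1])
    show "\<bar>\<bar>n \<bullet> y\<bar>\<bar> \<le> 1" if "norm y < 1" for y
      using Cauchy_Schwarz_ineq2[of n y] assms that by simp
  qed measurable
  let ?U = "ball 0 1 \<inter> {y. n \<bullet> y \<noteq> 0}"
  have "open ?U"
    by (intro open_Int open_ball open_Collect_neq continuous_intros)
  moreover have "(1/2) *\<^sub>R n \<in> ?U"
    using assms by (simp add: dot_square_norm)
  ultimately have ne: "interior ?U \<noteq> {}"
    by (metis empty_iff interior_open)
  have "\<not> (AE y in lborel. bump_weight y * \<bar>n \<bullet> y\<bar> = 0)"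
  proof
    assume "AE y in lborel. bump_weight y * \<bar>n \<bullet> y\<bar> = 0"
    then have "AE y\<in>?U in lebesgue. bump_weight y * \<bar>n \<bullet> y\<bar> = 0"
      by (auto dest: AE_completion)
    then show False
      using ne
    proof (rule AE_on_nonempty_interior_imp_Ex)
      fix y assume "y \<in> interior ?U" "bump_weight y * \<bar>n \<bullet> y\<bar> = 0"
      then show False
        using interior_subset[of ?U] bump_weight_pos_iff[of y] by auto
    qed
  qed
  then have "(\<integral>y. bump_weight y * \<bar>n \<bullet> y\<bar> \<partial>lborel) \<noteq> 0"
    using int by (subst integral_nonneg_eq_0_iff_AE) (auto simp: bump_weight_nonneg)
  moreover have "(\<integral>y. bump_weight y * \<bar>n \<bullet> y\<bar> \<partial>lborel) \<ge> 0"
    by (intro Bochner_Integration.integral_nonneg) (simp add: bump_weight_nonneg)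
  ultimately show ?thesis by simp
qed

text \<open>The blow-up limit of the velocity at a point of an edge: w and w' are its values there
  taken from the two sides.\<close>

definition half_plane_field :: "real^2 \<Rightarrow> real^2 \<Rightarrow> real^2 \<Rightarrow> real^2 \<Rightarrow> real^2" where
  "half_plane_field n w w' y = (if n \<bullet> y < 0 then w else w')"

lemma measurable_half_plane_field [measurable]: "half_plane_field n w w' \<in> borel_measurable borel"
  unfolding half_plane_field_def by measurable

lemma abs_half_plane_field_inner_le:
  assumes "norm z \<le> 1"
  shows "\<bar>half_plane_field n w w' y \<bullet> z\<bar> \<le> norm w + norm w'"
proof -
  have "\<bar>half_plane_field n w w' y \<bullet> z\<bar> \<le> norm (half_plane_field n w w' y) * norm z"
    by (rule Cauchy_Schwarz_ineq2)
  also have "\<dots> \<le> norm (half_plane_field n w w' y) * 1"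
    using assms by (intro mult_left_mono) auto
  also have "\<dots> \<le> norm w + norm w'"
    by (simp add: half_plane_field_def)
  finally show ?thesis .
qed

text \<open>Averaging over the reflection that fixes \<open>n\<close> removes the tangential components, averaging over
  the point reflection then leaves the jump of the normal components.\<close>

lemma integral_half_plane_field:
  assumes n: "norm n = 1"
  shows "(\<integral>y. bump_weight y * (half_plane_field n w w' y \<bullet> y) \<partial>lborel) =
    (w' \<bullet> n - w \<bullet> n) / 2 * (\<integral>y. bump_weight y * \<bar>n \<bullet> y\<bar> \<partial>lborel)"
proof -
  \<comment> \<open>R fixes n and reverses the tangential direction. As an isometry it preserves
    \<open>bump_weight\<close>, and it maps each side of the line to itself, so the half-plane field
    is unchanged.\<close>
  define R where "R = (\<lambda>y. (2 * (n \<bullet> y)) *\<^sub>R n - y)"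
  have normR: "norm (R y) = norm y" for y
  proof -
    have "R y \<bullet> R y = y \<bullet> y"
      using n unfolding R_def inner_diff_left inner_diff_right inner_scaleR_left inner_scaleR_right
      by (simp add: dot_square_norm inner_commute[of y n])
    then show ?thesis by (simp add: norm_eq_sqrt_inner)
  qed
  have "linear R"
    unfolding R_def by (intro linearI) (simp_all add: inner_add_right algebra_simps scaleR_2)
  with normR have R: "orthogonal_transformation R"
    by (simp add: orthogonal_transformation)
  have minus: "orthogonal_transformation (\<lambda>y::real^2. - y)"
    by (simp add: orthogonal_transformation_neg)
  have bwR: "bump_weight (R y) = bump_weight y" "bump_weight (- y) = bump_weight y" for y
    by (simp_all add: bump_weight_def normR)
  have nR: "n \<bullet> R y = n \<bullet> y" for y
    using n by (simp add: R_def inner_diff_right dot_square_norm)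
  let ?H = "half_plane_field n w w'"
  let ?f = "\<lambda>y. bump_weight y * (?H y \<bullet> y)"
  let ?g = "\<lambda>y. bump_weight y * ((?H y \<bullet> n) * (n \<bullet> y))"
  have [measurable]: "R \<in> borel_measurable borel"
    unfolding R_def by measurable
  have f: "integrable lborel ?f"
    by (rule integrable_bump_weight_mult[where M = "norm w + norm w'"])
       (auto intro!: abs_half_plane_field_inner_le)
  have "integrable lborel (\<lambda>y. bump_weight y * (?H y \<bullet> R y))"
    by (rule integrable_bump_weight_mult[where M = "norm w + norm w'"])
       (auto intro!: abs_half_plane_field_inner_le simp: normR)
  moreover have fR: "?f (R y) = bump_weight y * (?H y \<bullet> R y)" for y
    by (simp add: bwR nR half_plane_field_def)
  ultimately have fRi: "integrable lborel (\<lambda>y. ?f (R y))"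
    by (simp only: fR)
  have "2 * (\<integral>y. ?f y \<partial>lborel) = (\<integral>y. ?f y \<partial>lborel) + (\<integral>y. ?f (R y) \<partial>lborel)"
    by (subst integral_orthogonal_transformation[OF R, of ?f]) auto
  also have "\<dots> = (\<integral>y. ?f y + ?f (R y) \<partial>lborel)"
    by (rule Bochner_Integration.integral_add[symmetric, OF f fRi])
  \<comment> \<open>Here \<open>y + R y\<close> equals 2 (n \<bullet> y) n, so only normal
    components survive.\<close>
  also have "(\<lambda>y. ?f y + ?f (R y)) = (\<lambda>y. 2 * ?g y)"
  proof
    fix y
    have "?f y + ?f (R y) = bump_weight y * (?H y \<bullet> (y + R y))"
      unfolding fR by (simp add: inner_add_right algebra_simps)
    then show "?f y + ?f (R y) = 2 * ?g y"
      by (simp add: R_def)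
  qed
  finally have fg: "(\<integral>y. ?f y \<partial>lborel) = (\<integral>y. ?g y \<partial>lborel)" by simp
  have n_le: "\<bar>n \<bullet> y\<bar> \<le> 1" if "norm y < 1" for y
    using Cauchy_Schwarz_ineq2[of n y] n that by simp
  have gb: "\<bar>(half_plane_field n w w' z \<bullet> n) * (n \<bullet> y)\<bar> \<le> (norm w + norm w') * 1" if "norm y < 1" for y z
    unfolding abs_mult using that n
    by (intro mult_mono n_le abs_half_plane_field_inner_le) auto
  have g: "integrable lborel ?g"
    by (rule integrable_bump_weight_mult[where M = "(norm w + norm w') * 1"]) (measurable, rule gb)
  have "integrable lborel (\<lambda>y. bump_weight y * ((?H (- y) \<bullet> n) * (n \<bullet> (- y))))"
    by (rule integrable_bump_weight_mult[where M = "(norm w + norm w') * 1"]) (measurable, rule gb, simp)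
  then have gm: "integrable lborel (\<lambda>y. ?g (- y))"
    by (simp add: bwR)
  have "2 * (\<integral>y. ?g y \<partial>lborel) = (\<integral>y. ?g y \<partial>lborel) + (\<integral>y. ?g (- y) \<partial>lborel)"
    by (subst integral_orthogonal_transformation[OF minus, of ?g]) auto
  also have "\<dots> = (\<integral>y. ?g y + ?g (- y) \<partial>lborel)"
    by (rule Bochner_Integration.integral_add[symmetric, OF g gm])
  \<comment> \<open>The points y and -y lie on opposite sides: the one on the side of w' contributes
    with a plus sign, the other with a minus sign, each with weight |n \<bullet> y|.\<close>
  also have "(\<lambda>y. ?g y + ?g (- y)) = (\<lambda>y. (w' \<bullet> n - w \<bullet> n) * (bump_weight y * \<bar>n \<bullet> y\<bar>))"
    by (rule ext) (auto simp: half_plane_field_def bwR algebra_simps abs_if)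
  finally show ?thesis
    unfolding fg by simp
qed

section \<open>The two sides of the weak divergence identity for a bump\<close>

lemma grad_bump_alt:
  assumes "\<epsilon> > 0"
  shows "grad (bump x0 \<epsilon>) x = (- 2 / \<epsilon>\<^sup>2 * bump_weight ((1/\<epsilon>) *\<^sub>R (x - x0))) *\<^sub>R (x - x0)"
  using grad_bump[OF assms, of x0 "(1/\<epsilon>) *\<^sub>R (x - x0)"] assms
  by (simp add: power2_eq_square)

lemma borel_measurable_grad_bump:
  assumes "\<epsilon> > 0"
  shows "grad (bump x0 \<epsilon>) \<in> borel_measurable borel"
proof -
  have "(\<lambda>x. (- 2 / \<epsilon>\<^sup>2 * bump_weight ((1/\<epsilon>) *\<^sub>R (x - x0))) *\<^sub>R (x - x0)) \<in> borel_measurable borel"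
    by measurable
  then show ?thesis
    by (simp only: grad_bump_alt[OF assms, symmetric])
qed

lemma grad_bump_eq_0:
  assumes "\<epsilon> > 0" "x \<notin> ball x0 \<epsilon>"
  shows "grad (bump x0 \<epsilon>) x = 0"
proof -
  have "(1/\<epsilon>) *\<^sub>R (x - x0) \<notin> ball 0 1"
    using assms by (simp add: dist_norm norm_minus_commute)
  then show ?thesis
    using bump_weight_eq_0 by (simp add: grad_bump_alt[OF assms(1)])
qed

text \<open>Under x = x0 + \<epsilon> y the area element contributes \<epsilon>^2 and the gradient
  -2/\<epsilon>, hence the common factor -2 \<epsilon>. The linear part b (x - x0) of the field
  carries one more \<epsilon> and is a lower-order correction.\<close>

lemma integral_grad_bump:
  fixes v :: "real^2 \<Rightarrow> real^2"
  assumes n: "norm n = 1" and \<epsilon>: "\<epsilon> > 0" and \<Omega>: "\<Omega> \<in> sets lebesgue" "ball x0 \<epsilon> \<subseteq> \<Omega>"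
    and v: "set_borel_measurable lebesgue \<Omega> v"
    and lo: "AE x\<in>ball x0 \<epsilon> in lebesgue. n \<bullet> (x - x0) < 0 \<longrightarrow> v x = w + b *\<^sub>R (x - x0)"
    and up: "AE x\<in>ball x0 \<epsilon> in lebesgue. n \<bullet> (x - x0) \<ge> 0 \<longrightarrow> v x = w' + b' *\<^sub>R (x - x0)"
  shows "(LINT x:\<Omega>|lebesgue. v x \<bullet> grad (bump x0 \<epsilon>) x) =
    - 2 * \<epsilon> * ((\<integral>y. bump_weight y * (half_plane_field n w w' y \<bullet> y) \<partial>lborel) +
      \<epsilon> * (\<integral>y. bump_weight y * ((if n \<bullet> y < 0 then b else b') * (norm y)\<^sup>2) \<partial>lborel))"
proof -
  have [measurable]: "grad (bump x0 \<epsilon>) \<in> borel_measurable borel"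
    using \<epsilon> by (rule borel_measurable_grad_bump)
  then have [measurable]: "grad (bump x0 \<epsilon>) \<in> borel_measurable lebesgue"
    by (intro measurable_completion) simp
  define G where "G = (\<lambda>x. (if n \<bullet> (x - x0) < 0 then w + b *\<^sub>R (x - x0) else w' + b' *\<^sub>R (x - x0))
      \<bullet> grad (bump x0 \<epsilon>) x)"
  have [measurable]: "G \<in> borel_measurable borel"
    unfolding G_def by measurable
  have "(LINT x:\<Omega>|lebesgue. v x \<bullet> grad (bump x0 \<epsilon>) x) = (\<integral>x. G x \<partial>lebesgue)"
    unfolding set_lebesgue_integral_def
  proof (rule integral_cong_AE)
    have "(\<lambda>x. (indicator \<Omega> x *\<^sub>R v x) \<bullet> grad (bump x0 \<epsilon>) x) \<in> borel_measurable lebesgue"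
      using v unfolding set_borel_measurable_def by measurable
    then show "(\<lambda>x. indicator \<Omega> x *\<^sub>R (v x \<bullet> grad (bump x0 \<epsilon>) x)) \<in> borel_measurable lebesgue"
      by simp
    show "G \<in> borel_measurable lebesgue" by (intro measurable_completion) simp
    show "AE x in lebesgue. indicator \<Omega> x *\<^sub>R (v x \<bullet> grad (bump x0 \<epsilon>) x) = G x"
      using lo up
    proof eventually_elim
      case (elim x)
      show ?case
      proof (cases "x \<in> ball x0 \<epsilon>")
        case True
        then show ?thesis using elim \<Omega> by (auto simp: G_def)
      next
        case False
        then show ?thesis using \<epsilon> by (simp add: G_def grad_bump_eq_0)
      qed
    qed
  qed
  also have "\<dots> = (\<integral>x. G x \<partial>lborel)"
    by (rule integral_completion) simp
  also have "\<dots> = \<epsilon>\<^sup>2 * (\<integral>y. G (x0 + \<epsilon> *\<^sub>R y) \<partial>lborel)"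
    using \<epsilon> by (rule integral_affine_plane) simp
  also have "(\<lambda>y. G (x0 + \<epsilon> *\<^sub>R y)) = (\<lambda>y. (- 2 / \<epsilon>) * (bump_weight y * (half_plane_field n w w' y \<bullet> y) +
      \<epsilon> * (bump_weight y * ((if n \<bullet> y < 0 then b else b') * (norm y)\<^sup>2))))"
    using \<epsilon> by (intro ext) (auto simp: G_def grad_bump half_plane_field_def mult_less_0_iff inner_add_left
        power2_norm_eq_inner field_simps)
  also have "(\<integral>y. (- 2 / \<epsilon>) * (bump_weight y * (half_plane_field n w w' y \<bullet> y) +
      \<epsilon> * (bump_weight y * ((if n \<bullet> y < 0 then b else b') * (norm y)\<^sup>2))) \<partial>lborel) =
    (- 2 / \<epsilon>) * ((\<integral>y. bump_weight y * (half_plane_field n w w' y \<bullet> y) \<partial>lborel) +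
      \<epsilon> * (\<integral>y. bump_weight y * ((if n \<bullet> y < 0 then b else b') * (norm y)\<^sup>2) \<partial>lborel))"
  proof -
    have "integrable lborel (\<lambda>y. bump_weight y * (half_plane_field n w w' y \<bullet> y))"
      by (rule integrable_bump_weight_mult[where M = "norm w + norm w'"])
         (auto intro!: abs_half_plane_field_inner_le)
    moreover have "integrable lborel (\<lambda>y. bump_weight y * ((if n \<bullet> y < 0 then b else b') * (norm y)\<^sup>2))"
    proof (rule integrable_bump_weight_mult[where M = "(\<bar>b\<bar> + \<bar>b'\<bar>) * 1"])
      show "\<bar>(if n \<bullet> y < 0 then b else b') * (norm y)\<^sup>2\<bar> \<le> (\<bar>b\<bar> + \<bar>b'\<bar>) * 1" if "norm y < 1" for y
        unfolding abs_mult using that by (intro mult_mono) (auto simp: power_le_one)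
    qed measurable
    ultimately show ?thesis
      by (subst integral_mult_right_zero, subst Bochner_Integration.integral_add) auto
  qed
  finally show ?thesis
    using \<epsilon> by (simp add: power2_eq_square)
qed

text \<open>Young's inequality with weight N \<epsilon>: the term free of d is integrated over a
  disc of area proportional to \<epsilon>^2, so both terms acquire the factor \<epsilon> that the
  gradient side has. N stays free, to be chosen after the limit in \<epsilon>.\<close>

lemma abs_integral_mult_bump_le:
  fixes d :: "real^2 \<Rightarrow> real"
  assumes \<epsilon>: "\<epsilon> > 0" and \<Omega>: "ball x0 \<epsilon> \<subseteq> \<Omega>" and d: "in_L2 \<Omega> d" and N: "N > 0"
  shows "\<bar>LINT x:\<Omega>|lebesgue. d x * bump x0 \<epsilon> x\<bar> \<le>
    \<epsilon> / 2 * (N * (LINT x:ball x0 \<epsilon>|lebesgue. (d x)\<^sup>2) + measure lebesgue (ball (0::real^2) 1) / N)"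
proof -
  let ?B = "ball x0 \<epsilon>"
  have [measurable]: "(\<lambda>x. indicator \<Omega> x *\<^sub>R d x) \<in> borel_measurable lebesgue"
    using d by (simp add: in_L2_def set_borel_measurable_def)
  have "continuous_on UNIV (bump x0 \<epsilon>)"
    using C_diff_bump[of 0] by simp
  then have "bump x0 \<epsilon> \<in> borel_measurable lborel"
    by (simp add: borel_measurable_continuous_onI)
  then have [measurable]: "bump x0 \<epsilon> \<in> borel_measurable lebesgue"
    by (rule measurable_completion)
  have d2: "set_integrable lebesgue ?B (\<lambda>x. (d x)\<^sup>2)"
    by (rule set_integrable_subset[of lebesgue \<Omega>]) (use d \<Omega> in \<open>auto simp: in_L2_def\<close>)
  have B1: "integrable lebesgue (indicator ?B :: real^2 \<Rightarrow> real)"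
  proof (rule integrable_real_indicator)
    show "emeasure lebesgue ?B < \<infinity>"
      using emeasure_lborel_ball_finite[of x0 \<epsilon>] by (simp add: top.not_eq_extremum)
  qed simp
  have B2: "integrable lebesgue (\<lambda>x. indicator ?B x * (d x)\<^sup>2)"
    using d2 by (simp add: set_integrable_def)
  define h where "h = (\<lambda>x. (N * \<epsilon> / 2) * (indicator ?B x * (d x)\<^sup>2) + 1 / (2 * N * \<epsilon>) * indicator ?B x)"
  have h: "integrable lebesgue h"
    unfolding h_def
    by (rule Bochner_Integration.integrable_add[OF integrable_mult_right[OF B2] integrable_mult_right[OF B1]])
  have bound: "\<bar>indicator \<Omega> x *\<^sub>R (d x * bump x0 \<epsilon> x)\<bar> \<le> h x" for x
  proof (cases "x \<in> ?B")
    case True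
    have "\<bar>d x * bump x0 \<epsilon> x\<bar> \<le> \<bar>d x\<bar> * 1"
      unfolding abs_mult by (intro mult_left_mono bump_le_1) auto
    also have "\<dots> \<le> (N * \<epsilon> / 2) * (d x)\<^sup>2 + 1 / (2 * N * \<epsilon>)"
    proof -
      define L where "L = N * \<epsilon>"
      have L: "L > 0" using N \<epsilon> by (simp add: L_def)
      \<comment> \<open>Expanding this square and dividing by 2 L is the required form of Young's
        inequality.\<close>
      have "0 \<le> (L * \<bar>d x\<bar> - 1)\<^sup>2" by simp
      then have "2 * (L * \<bar>d x\<bar>) \<le> L\<^sup>2 * (d x)\<^sup>2 + 1"
        by (simp add: power2_diff power_mult_distrib)
      then have "\<bar>d x\<bar> \<le> (L\<^sup>2 * (d x)\<^sup>2 + 1) / (2 * L)"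
        using L by (simp add: pos_le_divide_eq mult_ac)
      also have "\<dots> = L / 2 * (d x)\<^sup>2 + 1 / (2 * L)"
        using L by (simp add: add_divide_distrib power2_eq_square)
      finally show ?thesis by (simp add: L_def mult.assoc)
    qed
    finally show ?thesis
      using True \<Omega> by (auto simp: h_def indicator_def)
  next
    case False
    then have "bump x0 \<epsilon> x = 0" using \<epsilon> by (simp add: bump_eq_0_iff)
    then show ?thesis using N \<epsilon> by (simp add: h_def)
  qed
  have "(\<lambda>x. (indicator \<Omega> x *\<^sub>R d x) * bump x0 \<epsilon> x) \<in> borel_measurable lebesgue"
    by measurable
  then have m: "(\<lambda>x. indicator \<Omega> x *\<^sub>R (d x * bump x0 \<epsilon> x)) \<in> borel_measurable lebesgue"
    by (simp add: mult.assoc)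
  have int: "integrable lebesgue (\<lambda>x. indicator \<Omega> x *\<^sub>R (d x * bump x0 \<epsilon> x))"
  proof (rule Bochner_Integration.integrable_bound[OF h m], rule AE_I2)
    show "norm (indicator \<Omega> x *\<^sub>R (d x * bump x0 \<epsilon> x)) \<le> norm (h x)" for x
      using order_trans[OF bound abs_ge_self] by (simp only: real_norm_def)
  qed
  have "\<bar>LINT x:\<Omega>|lebesgue. d x * bump x0 \<epsilon> x\<bar> \<le> (\<integral>x. h x \<partial>lebesgue)"
    unfolding set_lebesgue_integral_def using int h bound by (rule integral_abs_bound_integral)
  also have "\<dots> = (N * \<epsilon> / 2) * (LINT x:?B|lebesgue. (d x)\<^sup>2) + 1 / (2 * N * \<epsilon>) * measure lebesgue ?B"
    unfolding h_def set_lebesgue_integral_def using B1 B2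
    by (subst Bochner_Integration.integral_add) auto
  also have "measure lebesgue ?B = \<epsilon>\<^sup>2 * measure lebesgue (ball (0::real^2) 1)"
    using content_ball_conv_unit_ball[of \<epsilon> x0] \<epsilon> by simp
  also have "1 / (2 * N * \<epsilon>) * (\<epsilon>\<^sup>2 * measure lebesgue (ball (0::real^2) 1)) =
      \<epsilon> / 2 * (measure lebesgue (ball (0::real^2) 1) / N)"
    using N \<epsilon> by (simp add: power2_eq_square)
  also have "(N * \<epsilon> / 2) * (LINT x:?B|lebesgue. (d x)\<^sup>2) = \<epsilon> / 2 * (N * (LINT x:?B|lebesgue. (d x)\<^sup>2))"
    by simp
  finally show ?thesis
    by (simp only: distrib_left)
qed

text \<open>Dominated convergence: at every point other than x0 the truncated integrand is
  eventually 0, and a single point is null.\<close>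

lemma set_integral_shrinking_ball_tendsto_0:
  fixes f :: "real^2 \<Rightarrow> real"
  assumes f: "set_integrable lebesgue (ball x0 r) f" and \<epsilon>: "\<And>k. \<epsilon> k \<le> r" "\<epsilon> \<longlonglongrightarrow> 0"
  shows "(\<lambda>k. LINT x:ball x0 (\<epsilon> k)|lebesgue. f x) \<longlonglongrightarrow> 0"
proof -
  have "(\<lambda>k. \<integral>x. indicator (ball x0 (\<epsilon> k)) x *\<^sub>R f x \<partial>lebesgue) \<longlonglongrightarrow> integral\<^sup>L lebesgue (\<lambda>x::real^2. 0)"
  proof (rule integral_dominated_convergence)
    show "(\<lambda>x. indicator (ball x0 (\<epsilon> k)) x *\<^sub>R f x) \<in> borel_measurable lebesgue" for k
    proof -
      have "set_integrable lebesgue (ball x0 (\<epsilon> k)) f"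
        using \<epsilon>(1)[of k] by (intro set_integrable_subset[OF f]) auto
      then show ?thesis by (auto simp: set_integrable_def)
    qed
    show "integrable lebesgue (\<lambda>x. norm (indicator (ball x0 r) x *\<^sub>R f x))"
      using f by (simp only: set_integrable_def integrable_norm)
    show "AE x in lebesgue. norm (indicator (ball x0 (\<epsilon> k)) x *\<^sub>R f x) \<le> norm (indicator (ball x0 r) x *\<^sub>R f x)" for k
      using \<epsilon>(1)[of k] by (intro AE_I2) (auto simp: indicator_def)
    have "AE x in lebesgue. x \<noteq> x0"
      by (intro AE_completion AE_lborel_singleton)
    then show "AE x in lebesgue. (\<lambda>k. indicator (ball x0 (\<epsilon> k)) x *\<^sub>R f x) \<longlonglongrightarrow> 0"
    proof eventually_elim
      case (elim x)
      then have "\<forall>\<^sub>F k in sequentially. \<epsilon> k < dist x0 x"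
        using \<epsilon>(2) by (intro order_tendstoD) auto
      then have "\<forall>\<^sub>F k in sequentially. indicator (ball x0 (\<epsilon> k)) x *\<^sub>R f x = 0"
        by eventually_elim auto
      then show ?case by (rule tendsto_eventually)
    qed
  qed simp
  then show ?thesis by (simp add: set_lebesgue_integral_def)
qed

text \<open>Testing the weak divergence with the rescaled bumps \<^term>\<open>bump x0 \<epsilon>\<close>: the left side is of order
  \<open>\<epsilon>\<close> times the jump of the normal component, while Young's inequality and the absolute continuity
  of the integral of \<open>d\<^sup>2\<close> make the right side \<open>o(\<epsilon>)\<close>.\<close>

lemma Hdiv_normal_component_continuous:
  assumes "open \<Omega>" and v: "in_Hdiv \<Omega> v" and n: "norm n = 1" and r: "r > 0" "ball x0 r \<subseteq> \<Omega>"
    and lo: "AE x\<in>ball x0 r in lebesgue. n \<bullet> (x - x0) < 0 \<longrightarrow> v x = w + b *\<^sub>R (x - x0)"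
    and up: "AE x\<in>ball x0 r in lebesgue. n \<bullet> (x - x0) \<ge> 0 \<longrightarrow> v x = w' + b' *\<^sub>R (x - x0)"
  shows "w \<bullet> n = w' \<bullet> n"
proof -
  obtain d where d: "in_L2 \<Omega> d" "weak_divergence \<Omega> v d"
    using v by (auto simp: in_Hdiv_def)
  have v_meas: "set_borel_measurable lebesgue \<Omega> v"
    using v by (simp add: in_Hdiv_def in_L2_def)
  have \<Omega>: "\<Omega> \<in> sets lebesgue"
    using assms(1) by simp
  define J where "J = (\<integral>y. bump_weight y * (half_plane_field n w w' y \<bullet> y) \<partial>lborel)"
  define C where "C = (\<integral>y. bump_weight y * ((if n \<bullet> y < 0 then b else b') * (norm y)\<^sup>2) \<partial>lborel)"
  define D where "D = (\<lambda>\<epsilon>. LINT x:ball x0 \<epsilon>|lebesgue. (d x)\<^sup>2)"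
  define M where "M = measure lebesgue (ball (0::real^2) 1)"
  \<comment> \<open>The 2 in the denominator makes even the radius for k = 0 strictly smaller than
    r, so that the closed disc supporting the bump lies in \<Omega>.\<close>
  define \<epsilon> where "\<epsilon> = (\<lambda>k::nat. r / (2 + real k))"
  have \<epsilon>: "0 < \<epsilon> k" "\<epsilon> k < r" for k
    using r by (auto simp: \<epsilon>_def divide_less_eq intro: add_pos_nonneg)
  have \<epsilon>_lim: "\<epsilon> \<longlonglongrightarrow> 0"
    unfolding \<epsilon>_def by (rule real_tendsto_divide_at_top[OF tendsto_const])
      (intro filterlim_tendsto_add_at_top[OF tendsto_const] filterlim_real_sequentially)
  have D_lim: "(\<lambda>k. D (\<epsilon> k)) \<longlonglongrightarrow> 0"
    unfolding D_def
  proof (rule set_integral_shrinking_ball_tendsto_0[where r = r])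
    show "set_integrable lebesgue (ball x0 r) (\<lambda>x. (d x)\<^sup>2)"
      by (rule set_integrable_subset[of lebesgue \<Omega>]) (use d r in \<open>auto simp: in_L2_def\<close>)
  qed (use \<epsilon> \<epsilon>_lim in \<open>auto intro: less_imp_le\<close>)
  have bound: "\<bar>J + \<epsilon> k * C\<bar> \<le> (N * D (\<epsilon> k) + M / N) / 4" if "N > 0" for k N
  proof -
    have sub: "ball x0 (\<epsilon> k) \<subseteq> ball x0 r" "cball x0 (\<epsilon> k) \<subseteq> \<Omega>"
      using \<epsilon>[of k] r by auto
    have "test_function \<Omega> (bump x0 (\<epsilon> k))"
      by (rule test_function_bump[OF \<epsilon>(1) sub(2)])
    then have "(LINT x:\<Omega>|lebesgue. v x \<bullet> grad (bump x0 (\<epsilon> k)) x) =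
        - (LINT x:\<Omega>|lebesgue. d x * bump x0 (\<epsilon> k) x)"
      using d by (simp add: weak_divergence_def)
    moreover have "(LINT x:\<Omega>|lebesgue. v x \<bullet> grad (bump x0 (\<epsilon> k)) x) = - 2 * \<epsilon> k * (J + \<epsilon> k * C)"
      unfolding J_def C_def
    proof (rule integral_grad_bump[OF n \<epsilon>(1) \<Omega> _ v_meas])
      show "ball x0 (\<epsilon> k) \<subseteq> \<Omega>" using sub r by auto
    qed (use lo up sub(1) in \<open>eventually_elim, auto\<close>)+
    ultimately have "2 * \<epsilon> k * (J + \<epsilon> k * C) = (LINT x:\<Omega>|lebesgue. d x * bump x0 (\<epsilon> k) x)"
      by simp
    then have "2 * \<epsilon> k * \<bar>J + \<epsilon> k * C\<bar> = \<bar>LINT x:\<Omega>|lebesgue. d x * bump x0 (\<epsilon> k) x\<bar>"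
      using \<epsilon>(1)[of k] by (metis abs_mult abs_of_pos mult_pos_pos zero_less_numeral)
    also have "\<dots> \<le> \<epsilon> k / 2 * (N * D (\<epsilon> k) + M / N)"
      unfolding D_def M_def using sub r d \<epsilon> that by (intro abs_integral_mult_bump_le) auto
    finally have "\<epsilon> k * \<bar>J + \<epsilon> k * C\<bar> \<le> \<epsilon> k * ((N * D (\<epsilon> k) + M / N) / 4)"
      by simp
    then show ?thesis
      using \<epsilon>(1)[of k] by (simp only: mult_le_cancel_left_pos)
  qed
  \<comment> \<open>The limit in k is taken at fixed N: it removes both the correction
    \<open>\<epsilon> k * C\<close> and the term D that N multiplies.\<close>
  have lim: "\<bar>J\<bar> \<le> M / (4 * N)" if "N > 0" for N
  proof -
    have "(\<lambda>k. \<bar>J + \<epsilon> k * C\<bar>) \<longlonglongrightarrow> \<bar>J + 0 * C\<bar>"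
      by (intro tendsto_intros \<epsilon>_lim)
    moreover have "(\<lambda>k. (N * D (\<epsilon> k) + M / N) / 4) \<longlonglongrightarrow> (N * 0 + M / N) / 4"
      by (intro tendsto_intros D_lim) auto
    ultimately have "\<bar>J + 0 * C\<bar> \<le> (N * 0 + M / N) / 4"
      using bound[OF that] by (intro LIMSEQ_le) auto
    then show ?thesis by simp
  qed
  \<comment> \<open>The choice N = \<open>M / (2 * \<bar>J\<bar>)\<close> turns the bound into |J|
    <= |J|/2.\<close>
  have "J = 0"
  proof (rule ccontr)
    assume "J \<noteq> 0"
    have "M > 0" unfolding M_def using content_ball_pos[of 1 "0::real^2"] by simp
    with \<open>J \<noteq> 0\<close> lim[of "M / (2 * \<bar>J\<bar>)"] show False by (simp add: field_simps)
  qed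
  then show ?thesis
    using integral_half_plane_field[OF n, of w w'] integral_bump_weight_pos[OF n] by (simp add: J_def)
qed

section \<open>Traces and the upwind scheme\<close>

lemma Qh_cell_value:
  assumes "q \<in> Qh \<Omega> T" "K \<in> T" "interior K \<noteq> {}"
  shows "AE x\<in>K in lebesgue. q x = cell_value K q"
proof -
  obtain c where "AE x\<in>K in lebesgue. q x = c"
    using assms by (auto simp: Qh_def)
  with cell_value_eqI[OF this assms(3)] show ?thesis by simp
qed

lemma Vh_cell_field:
  assumes "v \<in> Vh \<Omega> T" "K \<in> T" "interior K \<noteq> {}"
  shows "cell_field K v \<in> RT0" "AE x\<in>K in lebesgue. v x = cell_field K v x"
proof -
  obtain p where "p \<in> RT0" "AE x\<in>K in lebesgue. v x = p x"
    using assms(1,2) unfolding Vh_def by blast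
  with cell_field_eqI[OF this assms(3)]
  show "cell_field K v \<in> RT0" "AE x\<in>K in lebesgue. v x = cell_field K v x" by simp_all
qed

lemma outward_normal_const_on_edge:
  assumes "2 simplex K" "E edge_of K" "x \<in> E" "y \<in> E"
  shows "x \<bullet> outward_normal K E = y \<bullet> outward_normal K E"
proof -
  obtain a b n \<delta> where *: "E = closed_segment a b" "a \<noteq> b" "outward_normal K E = n" "norm n = 1"
    "n \<bullet> (b - a) = 0" "\<delta> > 0"
    "\<And>x. dist (midpoint a b) x < \<delta> \<Longrightarrow> n \<bullet> (x - midpoint a b) \<le> 0 \<Longrightarrow> x \<in> K"
    by (rule triangle_near_edge[OF assms(1,2)]) blast
  have "E \<subseteq> {x. n \<bullet> x = n \<bullet> a}"
    unfolding *(1) segment_convex_hull using *(5)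
    by (simp add: subset_hull convex_hyperplane inner_diff_right)
  then have "n \<bullet> x = n \<bullet> a" "n \<bullet> y = n \<bullet> a"
    using assms(3,4) by blast+
  then show ?thesis
    unfolding *(3) by (simp add: inner_commute)
qed

text \<open>An edge lies on a level line of its normal, so a + b x has the same normal component at
  all of its points. This evaluates the definite description in
  \<open>normal_component\<close>.\<close>

lemma cell_field_inner_normal:
  assumes K: "2 simplex K" "E edge_of K" and p: "cell_field K v \<in> RT0" and x: "x \<in> E"
  shows "cell_field K v x \<bullet> outward_normal K E = outflow K E v"
proof -
  obtain a b where ab: "cell_field K v = (\<lambda>x. a + b *\<^sub>R x)"
    using p by (auto simp: RT0_def)
  have c: "cell_field K v y \<bullet> outward_normal K E = cell_field K v x \<bullet> outward_normal K E" if "y \<in> E" for y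
    unfolding ab inner_add_left inner_scaleR_left
    using outward_normal_const_on_edge[OF K that x] by simp
  show ?thesis
    unfolding normal_component_def
  proof (rule the_equality[symmetric])
    show "\<forall>y\<in>E. cell_field K v y \<bullet> outward_normal K E = cell_field K v x \<bullet> outward_normal K E"
      using c by blast
  next
    fix c assume "\<forall>y\<in>E. cell_field K v y \<bullet> outward_normal K E = c"
    with x show "c = cell_field K v x \<bullet> outward_normal K E" by (metis (no_types))
  qed
qed

text \<open>The outward normals are opposite, so equality of the normal components from both sides
  becomes a change of sign. Two neighbours thus cannot both have positive outflow through their
  common edge.\<close>

lemma outflow_opposite:
  assumes \<Omega>: "polygonal_domain \<Omega>" and T: "triangulates T \<Omega>" and u: "u \<in> Vh \<Omega> T"
    and K: "K \<in> T" "K' \<in> T" "K \<noteq> K'" and E: "E edge_of K" "E edge_of K'"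
  shows "outflow K' E u = - outflow K E u"
proof -
  have triangle: "2 simplex K" "2 simplex K'" and tri: "triangulation T" and un: "\<Union>T = closure \<Omega>"
    using T K by (auto simp: triangulates_def)
  obtain x0 n \<delta> where x0: "x0 \<in> E" "norm n = 1" "\<delta> > 0" "outward_normal K E = n" "outward_normal K' E = - n"
    and lo: "\<And>x. dist x0 x < \<delta> \<Longrightarrow> n \<bullet> (x - x0) \<le> 0 \<Longrightarrow> x \<in> K"
    and up: "\<And>x. dist x0 x < \<delta> \<Longrightarrow> n \<bullet> (x - x0) \<ge> 0 \<Longrightarrow> x \<in> K'"
    by (rule shared_edge_neighbourhood[OF tri K triangle E]) blast
  have "ball x0 \<delta> \<subseteq> K \<union> K'"
  proof
    fix x assume "x \<in> ball x0 \<delta>"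
    then show "x \<in> K \<union> K'" using lo[of x] up[of x] by (cases "n \<bullet> (x - x0) \<le> 0") auto
  qed
  also have "\<dots> \<subseteq> closure \<Omega>" using K un by blast
  \<comment> \<open>So far the disc is only known to lie in the closure of \<Omega>. The exclusion
    of slits, \<open>interior (closure \<Omega>) = \<Omega>\<close>, places it in \<Omega> itself;
    across a slit the two traces would be independent.\<close>
  finally have "ball x0 \<delta> \<subseteq> interior (closure \<Omega>)" by (simp add: interior_maximal)
  then have ball: "ball x0 \<delta> \<subseteq> \<Omega>" using \<Omega> by (simp add: polygonal_domain_def)
  note p = Vh_cell_field[OF u K(1) simplex_interior_nonempty[OF triangle(1)]]
  note p' = Vh_cell_field[OF u K(2) simplex_interior_nonempty[OF triangle(2)]]
  obtain a b where ab: "cell_field K u = (\<lambda>x. a + b *\<^sub>R x)" using p by (auto simp: RT0_def)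
  obtain a' b' where ab': "cell_field K' u = (\<lambda>x. a' + b' *\<^sub>R x)" using p' by (auto simp: RT0_def)
  \<comment> \<open>Both polynomials are re-centred at x0, as in a + b x = (a + b x0) + b (x - x0),
    so the constant parts are the traces at x0.\<close>
  have "cell_field K u x0 \<bullet> n = cell_field K' u x0 \<bullet> n"
  proof (rule Hdiv_normal_component_continuous[of \<Omega> u n \<delta> x0 _ b _ b'])
    show "AE x\<in>ball x0 \<delta> in lebesgue. n \<bullet> (x - x0) < 0 \<longrightarrow> u x = cell_field K u x0 + b *\<^sub>R (x - x0)"
      using p(2)
    proof eventually_elim
      case (elim x)
      then show ?case using lo[of x] by (auto simp: ab algebra_simps)
    qed
    show "AE x\<in>ball x0 \<delta> in lebesgue. n \<bullet> (x - x0) \<ge> 0 \<longrightarrow> u x = cell_field K' u x0 + b' *\<^sub>R (x - x0)"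
      using p'(2)
    proof eventually_elim
      case (elim x)
      then show ?case using up[of x] by (auto simp: ab' algebra_simps)
    qed
  qed (use \<Omega> u x0 ball in \<open>auto simp: polygonal_domain_def Vh_def\<close>)
  then show ?thesis
    using cell_field_inner_normal[OF triangle(1) E(1) p(1) x0(1)]
      cell_field_inner_normal[OF triangle(2) E(2) p'(1) x0(1)] x0 by simp
qed

text \<open>The intersection is convex with empty interior, hence negligible.\<close>

lemma triangulation_AE_disjoint:
  fixes T :: "(real^2) set set"
  assumes "triangulation T" "K \<in> T" "K' \<in> T" "K \<noteq> K'" "2 simplex K" "2 simplex K'"
  shows "AE x in lebesgue. x \<in> K \<longrightarrow> x \<notin> K'"
proof -
  have "negligible (K \<inter> K')"
    using triangulation_interior_Int[OF assms] assms(5,6)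
    by (simp add: negligible_convex_interior convex_Int simplex_compact_convex)
  then have "AE x in lebesgue. x \<notin> K \<inter> K'"
    by (intro AE_not_in) (simp add: negligible_iff_null_sets)
  then show ?thesis by eventually_elim auto
qed

section \<open>Indicators of triangles as test functions\<close>

lemma indicator_in_Qh:
  assumes \<Omega>: "polygonal_domain \<Omega>" and T: "triangulates T \<Omega>" and K: "K \<in> T"
  shows "indicator K \<in> Qh \<Omega> T"
proof -
  have triangle: "\<And>K'. K' \<in> T \<Longrightarrow> 2 simplex K'" and tri: "triangulation T"
    using T by (auto simp: triangulates_def)
  have [measurable]: "K \<in> sets lebesgue" "\<Omega> \<in> sets lebesgue"
    using simplex_compact_convex(1)[OF triangle[OF K]] \<Omega> by (auto simp: polygonal_domain_def compact_imp_closed)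
  have "set_integrable lebesgue \<Omega> (\<lambda>x. (norm (indicator K x :: real))\<^sup>2)"
    unfolding set_integrable_def
  proof (rule integrableI_bounded_set_indicator[where B = 1])
    have "emeasure lebesgue \<Omega> < \<infinity>"
      using emeasure_bounded_finite[of \<Omega>] \<Omega> by (simp add: polygonal_domain_def top.not_eq_extremum)
    then show "emeasure lebesgue \<Omega> < \<infinity>" .
  qed (auto simp: indicator_def)
  then have "in_L2 \<Omega> (indicator K :: real^2 \<Rightarrow> real)"
    by (auto simp: in_L2_def set_borel_measurable_def)
  moreover have "\<exists>c. AE x\<in>K' in lebesgue. (indicator K x :: real) = c" if "K' \<in> T" for K'
  proof (cases "K' = K")
    case True
    then show ?thesis by (intro exI[of _ 1]) auto
  next
    case False
    have "AE x in lebesgue. x \<in> K' \<longrightarrow> x \<notin> K"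
      using False that K triangle by (intro triangulation_AE_disjoint[OF tri]) auto
    then have "AE x\<in>K' in lebesgue. (indicator K x :: real) = 0"
      by eventually_elim auto
    then show ?thesis ..
  qed
  ultimately show ?thesis by (simp add: Qh_def)
qed

text \<open>Points on a common edge belong to K, but they are null in the neighbour, so the trace
  from the neighbour is 0. In the advection term only the boundary integral over K itself
  survives.\<close>

lemma cell_value_indicator:
  assumes T: "triangulation T" "K \<in> T" "K' \<in> T" "2 simplex K" "2 simplex K'"
  shows "cell_value K' (indicator K) = of_bool (K' = K)"
proof (rule cell_value_eqI[OF _ simplex_interior_nonempty[OF T(5)]])
  show "AE x\<in>K' in lebesgue. (indicator K x :: real) = of_bool (K' = K)"
  proof (cases "K' = K")
    case False
    then have "AE x in lebesgue. x \<in> K' \<longrightarrow> x \<notin> K"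
      using T by (intro triangulation_AE_disjoint[OF T(1)]) auto
    then show ?thesis
      by eventually_elim (use False in auto)
  qed auto
qed

text \<open>Measurability of f on K is inherited from the constant, by completeness of Lebesgue
  measure.\<close>

lemma integral_AE_const:
  fixes f :: "real^2 \<Rightarrow> real"
  assumes K: "K \<in> sets lebesgue" and ae: "AE x\<in>K in lebesgue. f x = c"
  shows "(LINT x:K|lebesgue. f x) = measure lebesgue K * c"
proof -
  have ae': "AE x in lebesgue. indicator K x *\<^sub>R c = indicator K x *\<^sub>R f x"
    using ae by eventually_elim (auto simp: indicator_def)
  have m: "(\<lambda>x. indicator K x *\<^sub>R c) \<in> borel_measurable lebesgue"
    using K by simp
  have "(\<lambda>x. indicator K x *\<^sub>R f x) \<in> borel_measurable lebesgue"
    using m ae' by (rule borel_measurable_AE)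
  then have "(LINT x:K|lebesgue. f x) = (\<integral>x. indicator K x *\<^sub>R c \<partial>lebesgue)"
    unfolding set_lebesgue_integral_def by (rule integral_cong_AE[OF m _ ae', symmetric])
  also have "\<dots> = measure lebesgue K * c"
    using K by simp
  finally show ?thesis .
qed

lemma mass_indicator:
  assumes T: "triangulation T" "\<And>K. K \<in> T \<Longrightarrow> 2 simplex K" and K: "K \<in> T"
    and f: "AE x\<in>K in lebesgue. f x = c"
  shows "mass T f (indicator K) = area K * c"
proof -
  have "(LINT x:K'|lebesgue. f x * indicator K x) = (if K' = K then area K * c else 0)" if "K' \<in> T" for K'
  proof (cases "K' = K")
    case True
    have "K \<in> sets lebesgue"
      using simplex_compact_convex(1)[OF T(2)[OF K]] by (simp add: compact_imp_closed)
    moreover have "AE x\<in>K in lebesgue. f x * indicator K x = c"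
      using f by eventually_elim auto
    ultimately show ?thesis
      using True integral_AE_const[of K "\<lambda>x. f x * indicator K x" c] by simp
  next
    case False
    then have "AE x in lebesgue. x \<in> K' \<longrightarrow> x \<notin> K"
      using T K that by (intro triangulation_AE_disjoint[OF T(1)]) auto
    then have "AE x in lebesgue. indicator K' x *\<^sub>R (f x * indicator K x) = 0"
      by eventually_elim (auto simp: indicator_def)
    then show ?thesis
      unfolding set_lebesgue_integral_def using False by (simp add: integral_eq_zero_AE)
  qed
  then show ?thesis
    using T(1) K by (simp add: mass_def triangulation_def sum.delta)
qed

lemma advection_indicator:
  assumes T: "triangulation T" "\<And>K. K \<in> T \<Longrightarrow> 2 simplex K" and K: "K \<in> T" and u: "u \<in> Vh \<Omega> T"
  shows "advection T \<gamma> u (indicator K) = (\<Sum>E\<in>edges_of K. edge_length E * (\<gamma> E * outflow K E u))"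
proof -
  have "edge_integral E (\<lambda>x. \<gamma> E * (cell_field K' u x \<bullet> outward_normal K' E) * cell_value K' (indicator K)) =
      (if K' = K then edge_length E * (\<gamma> E * outflow K E u) else 0)"
    if K': "K' \<in> T" and E: "E edge_of K'" for K' E
  proof -
    obtain a b c where E': "E = closed_segment a b"
      by (rule triangle_edge_vertices[OF T(2)[OF K'] E]) blast
    have "cell_field K' u \<in> RT0"
      by (rule Vh_cell_field(1)[OF u K' simplex_interior_nonempty[OF T(2)[OF K']]])
    then have "edge_integral E (\<lambda>x. \<gamma> E * (cell_field K' u x \<bullet> outward_normal K' E) * cell_value K' (indicator K)) =
        edge_length E * (\<gamma> E * outflow K' E u * cell_value K' (indicator K))"
      using cell_field_inner_normal[OF T(2)[OF K'] E]
      by (intro edge_integral_const[OF E']) simp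
    then show ?thesis
      using cell_value_indicator[OF T(1) K K' T(2)[OF K] T(2)[OF K']] by simp
  qed
  then have "advection T \<gamma> u (indicator K) =
      (\<Sum>K'\<in>T. if K' = K then \<Sum>E\<in>edges_of K. edge_length E * (\<gamma> E * outflow K E u) else 0)"
    unfolding advection_def by (intro sum.cong) (auto intro!: sum.neutral)
  also have "\<dots> = (\<Sum>E\<in>edges_of K. edge_length E * (\<gamma> E * outflow K E u))"
    using T(1) K by (simp add: triangulation_def sum.delta)
  finally show ?thesis .
qed

text \<open>Nonnegativity is given on the open set \<Omega>, while K is only contained in its
  closure; the interior of K lies in \<Omega> and is large enough to supply a point.\<close>

lemma cell_value_nonneg:
  assumes \<Omega>: "polygonal_domain \<Omega>" and T: "triangulates T \<Omega>" and q: "q \<in> Qh \<Omega> T"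
    and nonneg: "AE x\<in>\<Omega> in lebesgue. q x \<ge> 0" and K: "K \<in> T"
  shows "cell_value K q \<ge> 0"
proof -
  have "interior K \<noteq> {}"
    using T K by (auto simp: triangulates_def intro!: simplex_interior_nonempty)
  have "K \<subseteq> closure \<Omega>" using T K by (auto simp: triangulates_def)
  then have int: "interior K \<subseteq> \<Omega>"
    using \<Omega> interior_mono[of K "closure \<Omega>"] by (simp add: polygonal_domain_def)
  have "AE x\<in>interior K in lebesgue. q x = cell_value K q \<and> 0 \<le> q x"
    using Qh_cell_value[OF q K \<open>interior K \<noteq> {}\<close>] nonneg
    by eventually_elim (use int interior_subset in auto)
  then show ?thesis
    by (rule AE_on_nonempty_interior_imp_Ex) (use \<open>interior K \<noteq> {}\<close> in auto)
qed

text \<open>The cases follow the upwind element, not the sign of the flux. If it is K, equality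
  holds; otherwise the flux out of K is at most 0 and the carried density is nonnegative. A
  vanishing flux may be labelled either way, and both sides are then 0.\<close>

lemma upwind_flux_le:
  assumes \<Omega>: "polygonal_domain \<Omega>" and T: "triangulates T \<Omega>" and u: "u \<in> Vh \<Omega> T"
    and up: "upwind_value T u \<rho> \<rho>hat" and nonneg: "\<And>K. K \<in> T \<Longrightarrow> cell_value K \<rho> \<ge> 0"
    and K: "K \<in> T" "E edge_of K"
  shows "\<rho>hat E * outflow K E u \<le> (if 0 \<le> outflow K E u then cell_value K \<rho> * outflow K E u else 0)"
proof -
  have "E \<in> mesh_edges T" using K by (auto simp: mesh_edges_def)
  then obtain K' where K': "K' \<in> T" "E edge_of K'" "0 \<le> outflow K' E u" "\<rho>hat E = cell_value K' \<rho>"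
    using up by (auto simp: upwind_value_def)
  show ?thesis
  proof (cases "K' = K")
    case True
    then show ?thesis using K' by simp
  next
    case False
    then have "outflow K E u \<le> 0"
      using outflow_opposite[OF \<Omega> T u K(1) K'(1) _ K(2) K'(2)] K'(3) by auto
    moreover have "\<rho>hat E \<ge> 0" using K' nonneg by simp
    ultimately show ?thesis
      by (auto simp: mult_nonneg_nonpos)
  qed
qed

theorem theorem3p2:
  fixes \<Omega> :: "(real^2) set" and T :: "(real^2) set set"
    and nE :: "(real^2) set \<Rightarrow> real^2"
    and Mbar :: "(real^2 \<Rightarrow> real^2) \<Rightarrow> (real^2 \<Rightarrow> real^2) \<Rightarrow> real"
    and m \<Delta>t :: real and pow :: "real \<Rightarrow> real"
    and \<rho>_old \<rho> \<mu> :: "real^2 \<Rightarrow> real" and u :: "real^2 \<Rightarrow> real^2"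
    and \<rho>hat :: "(real^2) set \<Rightarrow> real"
  assumes "polygonal_domain \<Omega>" and "triangulates T \<Omega>"
    and "\<forall>E\<in>mesh_edges T. unit_normal E (nE E)"
    and "Mbar = velocity_mass T \<or> Mbar = velocity_mass_lumped T nE"
    and "m > 1" and "\<Delta>t > 0" and "power_convention m pow"
    and "\<rho>_old \<in> Qh \<Omega> T" and "AE x\<in>\<Omega> in lebesgue. \<rho>_old x \<ge> 0"
    and "\<rho> \<in> Qh \<Omega> T" and "\<mu> \<in> Qh \<Omega> T" and "u \<in> Vh \<Omega> T"
    and "upwind_value T u \<rho>_old \<rho>hat"
    and "\<forall>q\<in>Qh \<Omega> T. mass T (\<lambda>x. (\<rho> x - \<rho>_old x) / \<Delta>t) q + advection T \<rho>hat u q = 0"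
    and "\<forall>v\<in>Vh \<Omega> T. Mbar u v - advection_bar T \<mu> v = 0"
    and "\<forall>r\<in>Qh \<Omega> T. mass T (\<lambda>x. \<mu> x - m / (m - 1) * pow (\<rho> x)) r = 0"
    and "CFL_condition T \<Delta>t u"
  shows "AE x\<in>\<Omega> in lebesgue. \<rho> x \<ge> 0"
proof -
  note \<Omega> = assms(1) and T = assms(2) and \<Delta>t = \<open>\<Delta>t > 0\<close> and u = \<open>u \<in> Vh \<Omega> T\<close>
  have tri: "triangulation T" and triangle: "\<And>K. K \<in> T \<Longrightarrow> 2 simplex K" and un: "\<Union>T = closure \<Omega>"
    using T by (auto simp: triangulates_def)
  have old: "cell_value K \<rho>_old \<ge> 0" if "K \<in> T" for K
    using cell_value_nonneg[OF \<Omega> T assms(8,9) that] .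
  have new: "cell_value K \<rho> \<ge> 0" if K: "K \<in> T" for K
  proof -
    have ne: "interior K \<noteq> {}" using triangle[OF K] by (rule simplex_interior_nonempty)
    define r0 r1 where "r0 = cell_value K \<rho>_old" and "r1 = cell_value K \<rho>"
    define S where "S = (\<Sum>E\<in>outflow_edges K u. \<bar>outflow K E u\<bar> * (edge_length E / area K))"
    have area: "area K > 0"
    proof -
      have "\<not> negligible K"
        using ne simplex_compact_convex(2)[OF triangle[OF K]] by (simp add: negligible_convex_interior)
      moreover have "K \<in> lmeasurable"
        using simplex_compact_convex(1)[OF triangle[OF K]] by (rule lmeasurable_compact)
      ultimately show ?thesis
        using negligible_iff_measure0[of K] by (metis measure_nonneg order_le_less)
    qed
    have fin: "finite (edges_of K)"
      by (rule finite_subset[OF _ finite_polytope_faces[OF simplex_imp_polytope[OF triangle[OF K]]]])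
         (auto simp: edge_of_def)
    have "AE x\<in>K in lebesgue. (\<rho> x - \<rho>_old x) / \<Delta>t = (r1 - r0) / \<Delta>t"
      using Qh_cell_value[OF assms(10) K ne] Qh_cell_value[OF assms(8) K ne]
      unfolding r0_def r1_def by eventually_elim simp
    then have "mass T (\<lambda>x. (\<rho> x - \<rho>_old x) / \<Delta>t) (indicator K) = area K * ((r1 - r0) / \<Delta>t)"
      by (intro mass_indicator[OF tri _ K] triangle)
    moreover have "mass T (\<lambda>x. (\<rho> x - \<rho>_old x) / \<Delta>t) (indicator K) + advection T \<rho>hat u (indicator K) = 0"
      using assms(14) indicator_in_Qh[OF \<Omega> T K] by blast
    ultimately have eq: "area K * ((r1 - r0) / \<Delta>t) = - (\<Sum>E\<in>edges_of K. edge_length E * (\<rho>hat E * outflow K E u))"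
      using advection_indicator[OF tri _ K u, of \<rho>hat] triangle by simp
    have "(\<Sum>E\<in>edges_of K. edge_length E * (\<rho>hat E * outflow K E u)) \<le>
        (\<Sum>E\<in>edges_of K. if 0 \<le> outflow K E u then edge_length E * (r0 * outflow K E u) else 0)"
    proof (rule sum_mono)
      fix E assume "E \<in> edges_of K"
      then have E: "E edge_of K" by simp
      have "bounded E"
        using edge_of_imp_subset[OF E] simplex_compact_convex(1)[OF triangle[OF K]]
        by (meson bounded_subset compact_imp_bounded)
      then have "edge_length E \<ge> 0" by (rule diameter_ge_0)
      then show "edge_length E * (\<rho>hat E * outflow K E u) \<le>
          (if 0 \<le> outflow K E u then edge_length E * (r0 * outflow K E u) else 0)"
        using mult_left_mono[OF upwind_flux_le[OF \<Omega> T u assms(13) old K E]]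
        unfolding r0_def by fastforce
    qed
    also have "\<dots> = (\<Sum>E\<in>outflow_edges K u. edge_length E * (r0 * outflow K E u))"
      unfolding outflow_edges_def using fin
      by (subst sum.inter_filter[symmetric]) auto
    \<comment> \<open>Fluxes through \<open>outflow_edges\<close> are nonnegative, so absolute
      values may be inserted; factoring out the area exposes the sum S of the CFL condition.\<close>
    also have "\<dots> = area K * (r0 * (\<Sum>E\<in>outflow_edges K u. \<bar>outflow K E u\<bar> * (edge_length E / area K)))"
      unfolding sum_distrib_left using area
      by (intro sum.cong) (auto simp: outflow_edges_def)
    finally have "- (area K * ((r1 - r0) / \<Delta>t)) \<le> area K * (r0 * S)"
      unfolding eq S_def by linarith
    then have "\<Delta>t * - (area K * ((r1 - r0) / \<Delta>t)) \<le> \<Delta>t * (area K * (r0 * S))"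
      using \<Delta>t by (simp only: mult_le_cancel_left_pos)
    also have "\<Delta>t * - (area K * ((r1 - r0) / \<Delta>t)) = area K * (r0 - r1)"
      using \<Delta>t by (simp add: field_simps)
    also have "\<Delta>t * (area K * (r0 * S)) = area K * (r0 * (\<Delta>t * S))"
      by (simp only: mult_ac)
    also have "\<dots> \<le> area K * (r0 * 1)"
      using assms(17) K old[OF K] area unfolding S_def CFL_condition_def r0_def
      by (intro mult_left_mono) auto
    finally have "r0 - r1 \<le> r0 * 1"
      using area by (simp only: mult_le_cancel_left_pos)
    then show ?thesis
      by (simp add: r1_def)
  qed
  \<comment> \<open>As T is finite, one null set serves all triangles; outside it each point of
    \<Omega> carries the cell value of a triangle that contains it.\<close>
  have "AE x in lebesgue. \<forall>K\<in>T. x \<in> K \<longrightarrow> \<rho> x = cell_value K \<rho>"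
  proof (rule AE_finite_allI)
    show "finite T" using tri by (simp add: triangulation_def)
    show "AE x\<in>K in lebesgue. \<rho> x = cell_value K \<rho>" if "K \<in> T" for K
      by (rule Qh_cell_value[OF assms(10) that simplex_interior_nonempty[OF triangle[OF that]]])
  qed
  then show ?thesis
  proof eventually_elim
    case (elim x)
    show ?case
    proof
      assume "x \<in> \<Omega>"
      then obtain K where "K \<in> T" "x \<in> K"
        using un closure_subset[of \<Omega>] by blast
      then show "0 \<le> \<rho> x" using elim new by simp
    qed
  qed
qed

end
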